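(* Let $m,n\in\mathbb{N}_0$ with $0\le m\le n$, $\sigma,\sigma'\in(0,\infty)$, and $\theta'\in(0,\pi)$. Then \[ \int_0^\pi Q_{m-1/2}(\chi)\,\mathrm{P}^m_n(\cos\theta)\sqrt{\sin\theta}\,d\theta=\frac{2\pi\sqrt{\sin\theta'}}{2n+1}\,\mathrm{P}^m_n(\cos\theta')\,e^{-(n+1/2)(\sigma_>-\sigma_<)}, \] where, with $s=\cosh\sigma$, $s'=\cosh\sigma'$, $\tau=\cos\theta$, $\tau'=\cos\theta'$, \[ \chi=\frac{\sin^2\theta\,(s'-\tau')^2+\sin^2\theta'\,(s-\tau)^2+\left[(s'-\tau')\sinh\sigma-(s-\tau)\sinh\sigma'\right]^2}{2\sin\theta\sin\theta'(s-\tau)(s'-\tau')}, \] and $\sigma_<=\min\{\sigma,\sigma'\}$, $\sigma_>=\max\{\sigma,\sigma'\}$.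
   Context: $Q_\nu=Q^0_\nu$, where for $z\in\mathbb{C}\setminus(-\infty,1]$, $Q^\mu_\nu(z)=e^{\mu\pi i}\frac{\sqrt{\pi}\,\Gamma(\nu+\mu+1)(z^2-1)^{\mu/2}}{2^{\nu+1}z^{\nu+\mu+1}}\,\mathbf{F}\!\left(\frac{\nu+\mu}{2}+1,\frac{\nu+\mu+1}{2};\nu+\frac32;\frac{1}{z^2}\right)$ with $\mathbf{F}={}_2F_1/\Gamma(c)$ (principal branches). $\mathrm{P}^m_n$ is the Ferrers function of the first kind: for integers $0\le m\le n$ and $x\in(-1,1)$, $\mathrm{P}^m_n(x)=(-1)^m(1-x^2)^{m/2}\frac{d^m}{dx^m}P_n(x)$ with $P_n$ the Legendre polynomial. Note $\chi\ge1$, with $\chi=1$ only when $\sigma=\sigma'$ and $\theta=\theta'$ (logarithmic singularity of $Q_{m-1/2}$). *)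

theory Defs
  imports "HOL-Analysis.Analysis" "HOL-Computational_Algebra.Polynomial"
begin

text \<open>Regularized Gauss hypergeometric function F = 2F1 / Gamma(c), via its power series
  (valid for |z| < 1, which is the only range used below).\<close>
definition hyp2F1_reg :: "complex \<Rightarrow> complex \<Rightarrow> complex \<Rightarrow> complex \<Rightarrow> complex" where
  "hyp2F1_reg a b c z =
     (\<Sum>k. pochhammer a k * pochhammer b k / (pochhammer c k * fact k) * z ^ k) / Gamma c"

definition legendreQ :: "complex \<Rightarrow> complex \<Rightarrow> complex \<Rightarrow> complex" where
  "legendreQ mu nu z =
     exp (mu * of_real pi * \<i>) * of_real (sqrt pi) * Gamma (nu + mu + 1) * (z\<^sup>2 - 1) powr (mu / 2)
     / ((2::complex) powr (nu + 1) * z powr (nu + mu + 1))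
     * hyp2F1_reg ((nu + mu) / 2 + 1) ((nu + mu + 1) / 2) (nu + 3 / 2) (1 / z\<^sup>2)"

definition legendreQ0 :: "complex \<Rightarrow> complex \<Rightarrow> complex" where
  "legendreQ0 nu z = legendreQ 0 nu z"

text \<open>Legendre polynomial via Rodrigues' formula.\<close>
definition legendre_poly :: "nat \<Rightarrow> real poly" where
  "legendre_poly n = smult (1 / (2 ^ n * fact n)) ((pderiv ^^ n) ([:-1, 0, 1:] ^ n))"

text \<open>Ferrers function of the first kind P^m_n(x), for x in (-1,1).\<close>
definition ferrersP :: "nat \<Rightarrow> nat \<Rightarrow> real \<Rightarrow> real" where
  "ferrersP m n x = (-1) ^ m * (1 - x\<^sup>2) powr (real m / 2) * poly ((pderiv ^^ m) (legendre_poly n)) x"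

definition chi :: "real \<Rightarrow> real \<Rightarrow> real \<Rightarrow> real \<Rightarrow> real" where
  "chi \<sigma> \<theta> \<sigma>' \<theta>' =
     (let s = cosh \<sigma>; s' = cosh \<sigma>'; \<tau> = cos \<theta>; \<tau>' = cos \<theta>' in
      ((sin \<theta>)\<^sup>2 * (s' - \<tau>')\<^sup>2 + (sin \<theta>')\<^sup>2 * (s - \<tau>)\<^sup>2
        + ((s' - \<tau>') * sinh \<sigma> - (s - \<tau>) * sinh \<sigma>')\<^sup>2)
      / (2 * sin \<theta> * sin \<theta>' * (s - \<tau>) * (s' - \<tau>')))"

end

theory Submission
  imports Defs "HOL-Real_Asymp.Real_Asymp"
begin

text \<open>
  Since \<open>chi = (c - t * y) / (sin \<theta> * sin \<theta>')\<close> with \<open>c = cosh (\<sigma> - \<sigma>')\<close>, \<open>t = cos \<theta>\<close>, \<open>y = cos \<theta>'\<close>, the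
  hypergeometric series turns the claim into a statement on the symmetric kernel
  \<open>G(t, y) = \<Sum>k. a\<^sub>k * ((1 - t\<^sup>2) * (1 - y\<^sup>2))\<^sup>k * (c - t * y) powr (- m - 1/2 - 2 * k)\<close>: the function \<open>D\<^sup>m P\<^sub>n\<close>
  is an eigenfunction of the integral operator with kernel \<open>G\<close> and weight \<open>(1 - t\<^sup>2)\<^sup>m\<close>.
  For \<open>c > 1\<close> the kernel satisfies \<open>L\<^sub>t G = L\<^sub>y G\<close> for the Gegenbauer operator
  \<open>L = (1 - t\<^sup>2) * \<partial>\<^sup>2 - (2 * m + 2) * t * \<partial>\<close>, which is self-adjoint for this weight. Hence the image \<open>F\<close> of
  \<open>D\<^sup>m P\<^sub>n\<close> is orthogonal to \<open>(L + \<mu>) t\<^sup>k\<close> for all \<open>k\<close>, where \<open>- \<mu>\<close> is the eigenvalue of \<open>D\<^sup>m P\<^sub>n\<close>, and by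
  Weierstrass' theorem \<open>F\<close> is a multiple of \<open>D\<^sup>m P\<^sub>n\<close>. The factor is read off at \<open>y = 1\<close>, where only the term
  \<open>k = 0\<close> survives. The singular case \<open>c = 1\<close> follows by letting \<open>c\<close> decrease to \<open>1\<close>: the kernel increases, so
  monotone convergence for \<open>n = m\<close>, where \<open>D\<^sup>m P\<^sub>m\<close> is constant, supplies a dominating function for all \<open>n\<close>.
\<close>

section \<open>Derivatives of Legendre polynomials\<close>

abbreviation legendre_deriv :: "nat \<Rightarrow> nat \<Rightarrow> real poly" where
  "legendre_deriv n m \<equiv> (pderiv ^^ m) (legendre_poly n)"

lemma funpow_pderiv_smult: "(pderiv ^^ k) (smult c p) = smult c ((pderiv ^^ k) (p :: real poly))"
  by (induction k) (auto simp: pderiv_smult)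

lemma degree_funpow_pderiv: "degree ((pderiv ^^ k) (p :: real poly)) = degree p - k"
  by (induction k) (auto simp: degree_pderiv)

text \<open>The function \<open>v = (x^2 - 1)^n\<close> solves the first-order equation
  \<open>(x^2 - 1) v' = 2 n x v\<close>. Differentiating it once gives the case
  \<open>k = 0\<close>, and each further differentiation raises \<open>k\<close> by one.\<close>

lemma rodrigues_base_deriv_recurrence:
  fixes n k :: nat and x :: real
  defines "v \<equiv> \<lambda>k x. poly ((pderiv ^^ k) ([:-1, 0, 1:] ^ n)) (x :: real)"
  shows "(x\<^sup>2 - 1) * v (k + 2) x = 2 * (real n - real k - 1) * x * v (k + 1) x
           + (real k + 1) * (2 * real n - real k) * v k x"
proof -
  have dv: "(v k has_real_derivative v (Suc k) x) (at x)" for k x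
    unfolding v_def by (simp add: poly_DERIV)
  have base: "(x\<^sup>2 - 1) * v 1 x = 2 * real n * x * v 0 x" for x
  proof (cases n)
    case (Suc j)
    have "pderiv ([:-1, 0, 1:] ^ Suc j :: real poly) = smult (real (Suc j)) ([:-1, 0, 1:] ^ j * [:0, 2:])"
      unfolding pderiv_power_Suc by (simp add: pderiv_pCons algebra_simps)
    then show ?thesis
      unfolding v_def Suc by (simp add: power2_eq_square algebra_simps)
  qed (simp add: v_def)
  have diff: "f' x = g' x"
    if "\<And>x. f x = g x" "\<And>x. (f has_real_derivative f' x) (at x)"
       "\<And>x. (g has_real_derivative g' x) (at x)" for f g f' g' :: "real \<Rightarrow> real" and x
  proof -
    have "f = g" using that(1) by auto
    then show ?thesis using that(2,3) DERIV_unique by blast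
  qed
  have l: "((\<lambda>x. (x\<^sup>2 - 1) * v k x) has_real_derivative (x\<^sup>2 - 1) * v (Suc k) x + 2 * x * v k x) (at x)" for k x
  proof -
    have "((\<lambda>x. x\<^sup>2 - 1) has_real_derivative 2 * x) (at x)" by (auto intro!: derivative_eq_intros)
    from DERIV_mult[OF this dv] show ?thesis by (simp add: algebra_simps)
  qed
  have r: "((\<lambda>x. a * x * v k x) has_real_derivative a * (x * v (Suc k) x + v k x)) (at x)" for a k x
  proof -
    have "((\<lambda>x. a * x) has_real_derivative a) (at x)" by (auto intro!: derivative_eq_intros)
    from DERIV_mult[OF this dv] show ?thesis by (simp add: algebra_simps)
  qed
  show ?thesis
  proof (induction k arbitrary: x)
    case 0
    have "(x\<^sup>2 - 1) * v 2 x + 2 * x * v 1 x = 2 * real n * (x * v 1 x + v 0 x)"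
      using diff[OF base l r, of x] by (simp add: numeral_2_eq_2)
    then show ?case by (simp add: algebra_simps numeral_2_eq_2)
  next
    case (Suc k)
    have "(x\<^sup>2 - 1) * v (k + 3) x + 2 * x * v (k + 2) x
        = 2 * (real n - real k - 1) * (x * v (k + 2) x + v (k + 1) x)
           + (real k + 1) * (2 * real n - real k) * v (k + 1) x"
      using diff[OF Suc l DERIV_add[OF r DERIV_cmult[OF dv]], of x] by (simp add: numeral_3_eq_3)
    then show ?case by (simp add: algebra_simps numeral_3_eq_3)
  qed
qed

text \<open>By Rodrigues' formula \<open>D^m P_n\<close> is a constant times the derivative of order
  \<open>n + m\<close> of \<open>(x^2 - 1)^n\<close>, so this is the preceding recurrence at
  \<open>k = n + m\<close>. It is Legendre's equation differentiated \<open>m\<close> times.\<close>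

lemma legendre_deriv_ode:
  "(1 - x\<^sup>2) * poly (legendre_deriv n (m + 2)) x - (2 * real m + 2) * x * poly (legendre_deriv n (m + 1)) x
     = - ((real n - real m) * (real n + real m + 1)) * poly (legendre_deriv n m) x"
proof -
  have eq: "poly (legendre_deriv n j) x
       = 1 / (2 ^ n * fact n) * poly ((pderiv ^^ (n + j)) ([:-1, 0, 1:] ^ n)) x" for j
    by (simp add: legendre_poly_def funpow_pderiv_smult funpow_add add.commute[of n] del: funpow.simps)
  define K where "K = 1 / (2 ^ n * fact n :: real)"
  define v where "v = (\<lambda>j. poly ((pderiv ^^ (n + m + j)) ([:-1, 0, 1:] ^ n)) x)"
  have v: "poly (legendre_deriv n (m + j)) x = K * v j" for j
    unfolding eq v_def K_def by (simp only: add.assoc)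
  have "(x\<^sup>2 - 1) * v 2 = 2 * (real n - real (n + m) - 1) * x * v 1
           + (real (n + m) + 1) * (2 * real n - real (n + m)) * v 0"
    using rodrigues_base_deriv_recurrence[of x "n + m" n] unfolding v_def by (simp only: add_0_right)
  then have "(x\<^sup>2 - 1) * v 2 = - (2 * real m + 2) * x * v 1 + (real n + real m + 1) * (real n - real m) * v 0"
    by (simp add: algebra_simps)
  then show ?thesis
    unfolding v using v[of 0] by (simp only: add_0_right) algebra
qed

lemma degree_legendre_deriv: "degree (legendre_deriv n m) = n - m"
  by (simp add: degree_funpow_pderiv legendre_poly_def degree_power_eq)

text \<open>A derivative vanishes only for a constant, and each differentiation lowers the degree by
  one. Starting from degree \<open>2 n\<close>, the \<open>n + m\<close> differentiations with
  \<open>m \<le> n\<close> never exhaust the degree.\<close>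

lemma legendre_deriv_nonzero: assumes "m \<le> n" shows "legendre_deriv n m \<noteq> 0"
proof -
  have "legendre_deriv n k \<noteq> 0" if "k \<le> n" for k
    using that
  proof (induction k)
    case 0
    have "(pderiv ^^ k) (([:-1, 0, 1:] :: real poly) ^ n) \<noteq> 0" if "k \<le> n" for k
      using that
    proof (induction k)
      case (Suc k)
      then show ?case
        by (auto simp: pderiv_eq_0_iff degree_funpow_pderiv degree_power_eq)
    qed auto
    then show ?case by (simp add: legendre_poly_def)
  next
    case (Suc k)
    then show ?case by (auto simp: pderiv_eq_0_iff degree_legendre_deriv)
  qed
  with assms show ?thesis by blast
qed

text \<open>The second-order term of the equation drops out at \<open>x = 1\<close>, which leaves a
  relation between consecutive derivatives. It drives the downward inductions on \<open>m\<close>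
  below.\<close>

lemma legendre_deriv_at_1:
  "(2 * real m + 2) * poly (legendre_deriv n (m + 1)) 1
     = (real n - real m) * (real n + real m + 1) * poly (legendre_deriv n m) 1"
  using legendre_deriv_ode[where x = 1 and n = n and m = m] by simp

lemma legendre_deriv_top: "poly (legendre_deriv n n) x = poly (legendre_deriv n n) 1"
proof -
  have "degree (legendre_deriv n n) = 0" by (simp add: degree_legendre_deriv)
  then obtain c where "legendre_deriv n n = [:c:]" by (rule degree_eq_zeroE)
  then show ?thesis by simp
qed

text \<open>Downward induction from the non-zero constant \<open>D^n P_n\<close>; the factors in the
  relation at 1 are positive as long as \<open>m < n\<close>. This value later serves as a divisor
  when the eigenvalue is read off.\<close>

lemma legendre_deriv_at_1_nonzero: assumes "m \<le> n" shows "poly (legendre_deriv n m) 1 \<noteq> 0"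
  using assms
proof (induction m rule: inc_induct)
  case base
  show ?case
  proof
    assume "poly (legendre_deriv n n) 1 = 0"
    then have "\<And>x. poly (legendre_deriv n n) x = 0" using legendre_deriv_top by metis
    then show False using legendre_deriv_nonzero[of n n] using poly_all_0_iff_0 by blast
  qed
next
  case (step m)
  then show ?case using legendre_deriv_at_1[of m n] by (auto simp del: funpow.simps)
qed

lemma poly_legendre_deriv_has_derivative:
  "(poly (legendre_deriv n m) has_real_derivative poly (legendre_deriv n (m + 1)) x) (at x within S)"
  by (simp add: poly_DERIV has_field_derivative_at_within)

section \<open>The integral against the kernel at the pole\<close>

lemma one_minus_square_power_deriv:
  "((\<lambda>t. (1 - t\<^sup>2) ^ Suc m) has_real_derivative - (2 * real m + 2) * t * (1 - t\<^sup>2) ^ m) (at t)" for t :: real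
proof -
  have "((\<lambda>t. 1 - t\<^sup>2) has_real_derivative - 2 * t) (at t)" by (auto intro!: derivative_eq_intros)
  from DERIV_power_Suc[OF this, of m] show ?thesis by (simp add: algebra_simps)
qed

text \<open>The derivative of \<open>t (1 - t^2)^(n + 1)\<close> integrates to zero, which links the
  exponents \<open>n\<close> and \<open>n + 1\<close>. The value is the Beta function B(1/2, n + 1),
  written with \<open>Gamma (real n + 1 / 2)\<close> to match \<open>heine_const\<close>.\<close>

lemma has_integral_one_minus_square_power:
  "((\<lambda>t. (1 - t\<^sup>2) ^ n) has_integral 2 * sqrt pi * fact n / ((2 * real n + 1) * Gamma (real n + 1 / 2))) {-1..1::real}"
proof (induction n)
  case 0
  show ?case using has_integral_const_real[of "1::real" "-1" 1] by (simp add: Gamma_one_half_real)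
next
  case (Suc n)
  let ?W = "2 * sqrt pi * fact n / ((2 * real n + 1) * Gamma (real n + 1 / 2))"
  have "((\<lambda>t. (1 - t\<^sup>2) ^ Suc n * (2 * real n + 3) - (2 * real n + 2) * (1 - t\<^sup>2) ^ n) has_integral
      1 * (1 - 1\<^sup>2) ^ Suc n - (-1) * (1 - (-1)\<^sup>2) ^ Suc n) {-1..1::real}"
  proof (rule fundamental_theorem_of_calculus)
    fix t :: real
    have "((\<lambda>t. t * (1 - t\<^sup>2) ^ Suc n) has_real_derivative
        1 * (1 - t\<^sup>2) ^ Suc n + - (2 * real n + 2) * t * (1 - t\<^sup>2) ^ n * t) (at t)"
      by (intro DERIV_mult DERIV_ident one_minus_square_power_deriv)
    also have "1 * (1 - t\<^sup>2) ^ Suc n + - (2 * real n + 2) * t * (1 - t\<^sup>2) ^ n * t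
        = (1 - t\<^sup>2) ^ Suc n * (2 * real n + 3) - (2 * real n + 2) * (1 - t\<^sup>2) ^ n"
      by (simp add: algebra_simps power2_eq_square)
    finally show "((\<lambda>t. t * (1 - t\<^sup>2) ^ Suc n) has_vector_derivative
        (1 - t\<^sup>2) ^ Suc n * (2 * real n + 3) - (2 * real n + 2) * (1 - t\<^sup>2) ^ n) (at t within {-1..1})"
      by (simp only: has_real_derivative_iff_has_vector_derivative has_vector_derivative_at_within)
  qed simp
  then have "((\<lambda>t. (1 - t\<^sup>2) ^ Suc n * (2 * real n + 3) - (2 * real n + 2) * (1 - t\<^sup>2) ^ n) has_integral 0) {-1..1::real}"
    by simp
  from has_integral_add[OF this has_integral_mult_right[OF Suc, of "2 * real n + 2"]]
  have "((\<lambda>t. (1 - t\<^sup>2) ^ Suc n * (2 * real n + 3)) has_integral (2 * real n + 2) * ?W) {-1..1::real}"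
    by simp
  from has_integral_divide[OF this, of "2 * real n + 3"]
  have "((\<lambda>t. (1 - t\<^sup>2) ^ Suc n) has_integral (2 * real n + 2) * ?W / (2 * real n + 3)) {-1..1::real}"
    by (simp add: add_nonneg_eq_0_iff)
  moreover have "Gamma (real (Suc n) + 1 / 2) = (real n + 1 / 2) * Gamma (real n + 1 / 2)"
  proof -
    have "real n + 1 / 2 \<notin> \<int>\<^sub>\<le>\<^sub>0" by (auto elim!: nonpos_Ints_cases')
    from Gamma_plus1[OF this] show ?thesis by (simp add: add_ac)
  qed
  ultimately have "((\<lambda>t. (1 - t\<^sup>2) ^ Suc n) has_integral (2 * real n + 2) * ?W / (2 * real n + 3)) {-1..1::real}"
     and G: "Gamma (real (Suc n) + 1 / 2) = (real n + 1 / 2) * Gamma (real n + 1 / 2)" by blast+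
  moreover have "(2 * real n + 2) * (2 * S * F / ((2 * real n + 1) * G)) / (2 * real n + 3)
      = 2 * S * ((real n + 1) * F) / ((2 * real n + 3) * ((real n + 1 / 2) * G))" if "G > 0" for S F G :: real
    using that by (simp add: divide_simps add_nonneg_eq_0_iff, simp add: algebra_simps)
  from this[of "Gamma (real n + 1 / 2)" "sqrt pi" "fact n"]
  have "(2 * real n + 2) * ?W / (2 * real n + 3)
      = 2 * sqrt pi * fact (Suc n) / ((2 * real (Suc n) + 1) * Gamma (real (Suc n) + 1 / 2))"
    unfolding G fact_Suc by (simp add: Gamma_real_pos algebra_simps)
  ultimately show ?case by simp
qed

text \<open>The substitution inverts \<open>v = (t - r) / sqrt (1 - 2 * r * t + r\<^sup>2)\<close>: geometrically, the angle at
  the centre of the unit circle is replaced by the angle at the interior point \<open>r\<close>.\<close>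

lemma has_integral_gegenbauer_generating:
  fixes r :: real and n :: nat
  assumes r: "0 \<le> r" "r < 1"
  assumes W: "((\<lambda>t. (1 - t\<^sup>2) ^ n) has_integral W) {-1..1::real}"
  shows "((\<lambda>t. (1 - t\<^sup>2) ^ n * (1 - 2 * r * t + r\<^sup>2) powr (- (real n + 1 / 2))) has_integral W) {-1..1}"
proof -
  \<comment> \<open>\<open>R v - r * v\<close> is the distance from the interior point
    \<open>r\<close> to the unit circle in the direction of cosine \<open>v\<close>, and
    \<open>g v\<close> is the value of \<open>t\<close> at the point reached.\<close>
  define R where "R v = sqrt (1 - r\<^sup>2 + r\<^sup>2 * v\<^sup>2)" for v
  define g where "g v = r * (1 - v\<^sup>2) + v * R v" for v
  define f where "f t = (1 - t\<^sup>2) ^ n * (1 - 2 * r * t + r\<^sup>2) powr (- (real n + 1 / 2))" for t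
  have r2: "r\<^sup>2 < 1" using r by (simp add: power_less_one_iff)
  have Rarg: "1 - r\<^sup>2 + r\<^sup>2 * v\<^sup>2 > 0" for v using r2 by (simp add: add_pos_nonneg)
  have Rpos: "R v > 0" and Rsq: "R v * R v = 1 - r\<^sup>2 + r\<^sup>2 * v\<^sup>2" for v
    using Rarg[of v] by (simp_all add: R_def)
  have d: "R v - r * v > 0" for v
  proof -
    have "(r * v)\<^sup>2 < (R v)\<^sup>2" using Rsq[of v] r2 by (simp add: power2_eq_square algebra_simps)
    then show ?thesis using Rpos[of v] power2_less_imp_less[of "r * v" "R v"] by simp
  qed
  have \<Delta>: "1 - 2 * r * g v + r\<^sup>2 = (R v - r * v)\<^sup>2" for v
    using Rsq[of v] unfolding g_def by algebra
  have g2: "1 - (g v)\<^sup>2 = (1 - v\<^sup>2) * (R v - r * v)\<^sup>2" for v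
    using Rsq[of v] unfolding g_def by algebra
  have R1: "R 1 = 1" "R (- 1) = 1" by (simp_all add: R_def)
  have g1: "g (- 1) = - 1" "g 1 = 1" by (simp_all add: g_def R1)
  have range: "g v \<in> {-1..1}" if "v \<in> {-1..1}" for v
  proof -
    have "v\<^sup>2 \<le> 1" using that by (simp add: abs_square_le_1 abs_le_iff)
    then have "(g v)\<^sup>2 \<le> 1" using g2[of v] by (smt (verit) mult_nonneg_nonneg zero_le_power2)
    then show ?thesis by (simp add: abs_square_le_1 abs_le_iff)
  qed
  have \<Delta>pos: "1 - 2 * r * t + r\<^sup>2 > 0" if "t \<in> {-1..1}" for t
  proof -
    have "r * t \<le> r * 1" using that r by (intro mult_left_mono) auto
    then have "1 - 2 * r * t + r\<^sup>2 \<ge> (1 - r)\<^sup>2" by (simp add: power2_eq_square algebra_simps)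
    moreover have "(1 - r)\<^sup>2 > 0" using r by simp
    ultimately show ?thesis by linarith
  qed
  have fcont: "continuous_on {-1..1} f"
    unfolding f_def by (intro continuous_intros) (use \<Delta>pos in force)+
  have gd: "(g has_real_derivative (R v - r * v) * (1 - r * v / R v)) (at v within {-1..1})" for v
  proof -
    have "(R has_real_derivative r\<^sup>2 * v / R v) (at v)"
      unfolding R_def using Rarg[of v]
      by (auto intro!: derivative_eq_intros simp: field_simps)
    then have "(g has_real_derivative r * (- 2 * v) + (v * (r\<^sup>2 * v / R v) + R v)) (at v)"
      unfolding g_def by (auto intro!: derivative_eq_intros)
    moreover have "r * (- 2 * v) + (v * (r\<^sup>2 * v / R v) + R v) = (R v - r * v) * (1 - r * v / R v)"
      using Rpos[of v] by (simp add: field_simps power2_eq_square)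
    ultimately show ?thesis by (simp add: has_field_derivative_at_within)
  qed
  have "((\<lambda>v. ((R v - r * v) * (1 - r * v / R v)) *\<^sub>R f (g v)) has_integral (integral {g (- 1)..g 1} f)) {-1..1}"
    by (rule has_integral_substitution[OF _ _ _ fcont gd]) (use range g1 in auto)
  then have A: "((\<lambda>v. (R v - r * v) * (1 - r * v / R v) * f (g v)) has_integral (integral {-1..1} f)) {-1..1}"
    by (simp add: g1)
  \<comment> \<open>The powers of the distance coming from the weight, the generating function and
    the Jacobian cancel completely. What remains is \<open>(1 - v^2)^n\<close> minus an odd function
    of \<open>v\<close>.\<close>
  have eq: "(R v - r * v) * (1 - r * v / R v) * f (g v) = (1 - v\<^sup>2) ^ n - (1 - v\<^sup>2) ^ n * (r * v / R v)" for v
  proof -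
    define x where "x = R v - r * v"
    have x: "x > 0" using d by (simp add: x_def)
    have "(x\<^sup>2) ^ n * (x\<^sup>2) powr (- (real n + 1 / 2)) = (x powr 2) powr (real n) * (x powr 2) powr (- (real n + 1 / 2))"
      using x by (simp add: powr_realpow powr_numeral)
    also have "\<dots> = x powr (- 1)"
      using x unfolding powr_powr powr_add[symmetric] by (simp add: algebra_simps)
    also have "\<dots> = 1 / x" using x by (simp add: powr_minus_divide)
    finally have *: "(x\<^sup>2) ^ n * (x\<^sup>2) powr (- (real n + 1 / 2)) = 1 / x" .
    have "(R v - r * v) * (1 - r * v / R v) * f (g v)
       = x * (1 - r * v / R v) * ((1 - v\<^sup>2) ^ n * ((x\<^sup>2) ^ n * (x\<^sup>2) powr (- (real n + 1 / 2))))"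
      unfolding f_def \<Delta> g2 x_def power_mult_distrib by (simp only: mult.assoc)
    also have "\<dots> = (1 - r * v / R v) * (1 - v\<^sup>2) ^ n" unfolding * using x by simp
    finally show ?thesis by (simp add: algebra_simps)
  qed
  \<comment> \<open>The odd part; reflection shows that its integral is zero, so the result does not
    depend on \<open>r\<close>.\<close>
  define h where "h v = (1 - v\<^sup>2) ^ n * (r * v / R v)" for v
  have "continuous_on {-1..1} R" unfolding R_def by (intro continuous_intros)
  then have "continuous_on {-1..1} h"
    unfolding h_def using Rpos by (intro continuous_intros) (auto simp: less_imp_neq[symmetric])
  then have h: "(h has_integral integral {-1..1} h) {-1..1}"
    by (intro integrable_integral integrable_continuous_real)
  then have "((\<lambda>v. h (- v)) has_integral integral {-1..1} h) {-1..1}"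
    using has_integral_reflect_real[where f = h and a = "-1" and b = 1] by simp
  moreover have "h (- v) = - h v" for v by (simp add: h_def R_def)
  ultimately have "((\<lambda>v. - h v) has_integral integral {-1..1} h) {-1..1}" by simp
  from has_integral_unique[OF this has_integral_neg[OF h]] have "integral {-1..1} h = 0" by simp
  with h have h0: "(h has_integral 0) {-1..1}" by simp
  have "((\<lambda>v. (1 - v\<^sup>2) ^ n - h v) has_integral W) {-1..1}"
    using has_integral_diff[OF W h0] by simp
  then have "integral {-1..1} f = W"
    using A unfolding eq h_def by (rule has_integral_unique[rotated])
  moreover have "(f has_integral integral {-1..1} f) {-1..1}"
    by (intro integrable_integral integrable_continuous_real fcont)
  ultimately have "(f has_integral W) {-1..1}" by simp
  then show ?thesis unfolding f_def .
qed

text \<open>The constant in front of the series for \<open>Q_(m - 1/2)\<close>: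
  \<open>z powr (- (m + 1/2))\<close> times the hypergeometric series in \<open>1/z^2\<close> has to
  be multiplied by it. The factorial is the \<open>Gamma c\<close> of the regularised
  function.\<close>

definition heine_const :: "nat \<Rightarrow> real" where
  "heine_const m = sqrt pi * Gamma (real m + 1 / 2) / (2 powr (real m + 1 / 2) * fact m)"

lemma heine_const_pos: "heine_const m > 0"
  unfolding heine_const_def by (intro divide_pos_pos mult_pos_pos Gamma_real_pos) auto

lemma heine_const_Suc: "heine_const (Suc m) * (2 * real m + 2) = heine_const m * (real m + 1 / 2)"
proof -
  have "real m + 1 / 2 \<notin> \<int>\<^sub>\<le>\<^sub>0" by (auto elim!: nonpos_Ints_cases')
  from Gamma_plus1[OF this] have "Gamma (real (Suc m) + 1 / 2) = (real m + 1 / 2) * Gamma (real m + 1 / 2)"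
    by (simp add: add_ac)
  moreover have "(2::real) powr (real (Suc m) + 1 / 2) = 2 * 2 powr (real m + 1 / 2)"
  proof -
    have "real (Suc m) + 1 / 2 = 1 + (real m + 1 / 2)" by simp
    then show ?thesis by (simp only: powr_add) simp
  qed
  ultimately have "heine_const (Suc m) = sqrt pi * ((real m + 1 / 2) * Gamma (real m + 1 / 2))
      / (2 * 2 powr (real m + 1 / 2) * ((real m + 1) * fact m))"
    unfolding heine_const_def by (simp add: algebra_simps)
  also have "\<dots> = heine_const m * ((real m + 1 / 2) / (2 * real m + 2))"
    unfolding heine_const_def by (simp add: algebra_simps)
  finally show ?thesis by (simp add: add_nonneg_eq_0_iff)
qed

text \<open>The parametrisation \<open>c = (1 + r^2) / (2 r)\<close>, that is
  \<open>c = cosh (ln r)\<close>, turns \<open>c - t\<close> into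
  \<open>(1 - 2 r t + r^2) / (2 r)\<close>, the base of the generating function.\<close>

lemma half_sum_inverse_gt_1:
  fixes r :: real
  assumes r: "0 < r" "r < 1"
  shows "(1 + r\<^sup>2) / (2 * r) > 1"
proof -
  have "(1 - r)\<^sup>2 > 0" using r by simp
  then have "1 + r\<^sup>2 > 2 * r" by (simp add: power2_eq_square algebra_simps)
  then show ?thesis using r by simp
qed

text \<open>This is the kernel integral at \<open>y = 1\<close>, where the kernel reduces to a power
  of \<open>c - t\<close>. The induction runs downward from \<open>m = n\<close>, where the
  polynomial is constant and the generating integral applies; the step is an integration by
  parts.\<close>

lemma has_integral_heine_pole:
  fixes r :: real
  assumes "m \<le> n" and r: "0 < r" "r < 1"
  defines "c \<equiv> (1 + r\<^sup>2) / (2 * r)"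
  shows "((\<lambda>t. (1 - t\<^sup>2) ^ m * poly (legendre_deriv n m) t * (c - t) powr (- (real m + 1 / 2))) has_integral
           2 * pi / (2 * real n + 1) * r powr (real n + 1 / 2) * poly (legendre_deriv n m) 1 / heine_const m) {-1..1}"
  using assms(1)
proof (induction m rule: inc_induct)
  case base
  let ?W = "2 * sqrt pi * fact n / ((2 * real n + 1) * Gamma (real n + 1 / 2))"
  have eq: "(c - t) powr (- (real n + 1 / 2)) = (2 * r) powr (real n + 1 / 2) * (1 - 2 * r * t + r\<^sup>2) powr (- (real n + 1 / 2))"
    if "t \<in> {-1..1}" for t
  proof -
    have ct: "c - t = (1 - 2 * r * t + r\<^sup>2) / (2 * r)" using r by (simp add: c_def field_simps)
    have "r * t \<le> r * 1" using that r by (intro mult_left_mono) auto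
    then have nn: "1 - 2 * r * t + r\<^sup>2 \<ge> 0" using zero_le_power2[of "1 - r"]
      by (simp add: power2_eq_square algebra_simps)
    have "(x / (2 * r)) powr (- a) = (2 * r) powr a * x powr (- a)" if "x \<ge> 0" for x a
      using r that by (simp add: powr_divide powr_minus divide_simps)
    from this[OF nn] show ?thesis unfolding ct .
  qed
  have "((\<lambda>t. poly (legendre_deriv n n) 1 * (2 * r) powr (real n + 1 / 2) *
           ((1 - t\<^sup>2) ^ n * (1 - 2 * r * t + r\<^sup>2) powr (- (real n + 1 / 2)))) has_integral
          poly (legendre_deriv n n) 1 * (2 * r) powr (real n + 1 / 2) * ?W) {-1..1}"
    using r by (intro has_integral_mult_right has_integral_gegenbauer_generating has_integral_one_minus_square_power) auto
  then have "((\<lambda>t. (1 - t\<^sup>2) ^ n * poly (legendre_deriv n n) t * (c - t) powr (- (real n + 1 / 2))) has_integral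
          poly (legendre_deriv n n) 1 * (2 * r) powr (real n + 1 / 2) * ?W) {-1..1}"
  proof (rule has_integral_eq[rotated])
    fix t :: real assume t: "t \<in> {-1..1}"
    show "poly (legendre_deriv n n) 1 * (2 * r) powr (real n + 1 / 2) *
           ((1 - t\<^sup>2) ^ n * (1 - 2 * r * t + r\<^sup>2) powr (- (real n + 1 / 2)))
       = (1 - t\<^sup>2) ^ n * poly (legendre_deriv n n) t * (c - t) powr (- (real n + 1 / 2))"
      unfolding eq[OF t] legendre_deriv_top[of n t] by (simp only: mult_ac)
  qed
  moreover have "P * (T * R) * (2 * s * F / (N * G)) = 2 * (s * s) / N * R * P / (s * G / (T * F))"
    if "G > 0" "s > 0" "T > 0" "F > 0" "N > 0" for P T R s F N G :: real
    using that by (simp add: field_simps)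
  from this[of "Gamma (real n + 1 / 2)" "sqrt pi" "2 powr (real n + 1 / 2)" "fact n" "2 * real n + 1"
       "poly (legendre_deriv n n) 1" "r powr (real n + 1 / 2)"]
  have "poly (legendre_deriv n n) 1 * (2 * r) powr (real n + 1 / 2) * ?W
     = 2 * pi / (2 * real n + 1) * r powr (real n + 1 / 2) * poly (legendre_deriv n n) 1 / heine_const n"
    using r by (simp add: heine_const_def powr_mult Gamma_real_pos)
  ultimately show ?case by simp
next
  case (step m)
  define \<mu> where "\<mu> = (real n - real m) * (real n + real m + 1)"
  have \<mu>: "\<mu> > 0" using step by (simp add: \<mu>_def)
  let ?p = "\<lambda>k. poly (legendre_deriv n k)"
  let ?g = "\<lambda>k t. (c - t) powr (- (real k + 1 / 2))"
  define C where "C = 2 * pi / (2 * real n + 1) * r powr (real n + 1 / 2)"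
  have c: "c > 1" unfolding c_def using r by (rule half_sum_inverse_gt_1)
  have dg: "(?g m has_real_derivative (real m + 1 / 2) * ?g (Suc m) t) (at t)" if "t \<in> {-1..1}" for t
  proof -
    have "((\<lambda>t. c - t) has_real_derivative - 1) (at t)" by (auto intro!: derivative_eq_intros)
    from DERIV_fun_powr[OF this, of "- (real m + 1 / 2)"] that c show ?thesis
      by (simp add: algebra_simps)
  qed
  \<comment> \<open>The antiderivative \<open>(1 - t^2)^(m + 1) * D^(m + 1) P_n * (c - t) powr (- (m
    + 1/2))\<close> vanishes at both endpoints. By the differential equation its derivative combines
    just the integrands for \<open>m + 1\<close> and \<open>m\<close>.\<close>
  have "((\<lambda>t. (real m + 1 / 2) * ((1 - t\<^sup>2) ^ Suc m * ?p (Suc m) t * ?g (Suc m) t)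
               - \<mu> * ((1 - t\<^sup>2) ^ m * ?p m t * ?g m t)) has_integral
      (1 - 1\<^sup>2) ^ Suc m * ?p (Suc m) 1 * ?g m 1 - (1 - (- 1)\<^sup>2) ^ Suc m * ?p (Suc m) (- 1) * ?g m (- 1)) {-1..1}"
  proof (rule fundamental_theorem_of_calculus)
    fix t :: real assume t: "t \<in> {-1..1}"
    have dp: "(?p (Suc m) has_real_derivative ?p (m + 2) t) (at t)"
      using poly_legendre_deriv_has_derivative[of n "Suc m" t UNIV] by simp
    have ode: "(1 - t\<^sup>2) * ?p (m + 2) t - (2 * real m + 2) * t * ?p (Suc m) t = - \<mu> * ?p m t"
      unfolding \<mu>_def using legendre_deriv_ode[where x = t and n = n and m = m] by simp
    have "((\<lambda>t. (1 - t\<^sup>2) ^ Suc m * ?p (Suc m) t * ?g m t) has_real_derivative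
       (- (2 * real m + 2) * t * (1 - t\<^sup>2) ^ m * ?p (Suc m) t + ?p (m + 2) t * (1 - t\<^sup>2) ^ Suc m) * ?g m t
         + (real m + 1 / 2) * ?g (Suc m) t * ((1 - t\<^sup>2) ^ Suc m * ?p (Suc m) t)) (at t)"
      by (intro DERIV_mult dg dp one_minus_square_power_deriv t)
    also have "(- (2 * real m + 2) * t * (1 - t\<^sup>2) ^ m * ?p (Suc m) t + ?p (m + 2) t * (1 - t\<^sup>2) ^ Suc m) * ?g m t
         + (real m + 1 / 2) * ?g (Suc m) t * ((1 - t\<^sup>2) ^ Suc m * ?p (Suc m) t)
       = (real m + 1 / 2) * ((1 - t\<^sup>2) ^ Suc m * ?p (Suc m) t * ?g (Suc m) t) + (1 - t\<^sup>2) ^ m * ?g m t *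
        ((1 - t\<^sup>2) * ?p (m + 2) t - (2 * real m + 2) * t * ?p (Suc m) t)"
      by (simp only: power_Suc) algebra
    also have "\<dots> = (real m + 1 / 2) * ((1 - t\<^sup>2) ^ Suc m * ?p (Suc m) t * ?g (Suc m) t)
               - \<mu> * ((1 - t\<^sup>2) ^ m * ?p m t * ?g m t)"
      unfolding ode by algebra
    finally show "((\<lambda>t. (1 - t\<^sup>2) ^ Suc m * ?p (Suc m) t * ?g m t) has_vector_derivative
       (real m + 1 / 2) * ((1 - t\<^sup>2) ^ Suc m * ?p (Suc m) t * ?g (Suc m) t)
               - \<mu> * ((1 - t\<^sup>2) ^ m * ?p m t * ?g m t)) (at t within {-1..1})"
      by (simp only: has_real_derivative_iff_has_vector_derivative has_vector_derivative_at_within)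
  qed simp
  from has_integral_diff[OF has_integral_mult_right[OF step.IH, of "real m + 1 / 2"] this]
  have "((\<lambda>t. \<mu> * ((1 - t\<^sup>2) ^ m * ?p m t * ?g m t)) has_integral
      (real m + 1 / 2) * (C * ?p (Suc m) 1 / heine_const (Suc m))) {-1..1}"
    by (simp add: C_def)
  from has_integral_divide[OF this, of \<mu>]
  have "((\<lambda>t. (1 - t\<^sup>2) ^ m * ?p m t * ?g m t) has_integral
      (real m + 1 / 2) * (C * ?p (Suc m) 1 / heine_const (Suc m)) / \<mu>) {-1..1}"
    using \<mu> by simp
  moreover have "(real m + 1 / 2) * (C * ?p (Suc m) 1 / heine_const (Suc m)) / \<mu> = C * ?p m 1 / heine_const m"
  proof -
    have 1: "(2 * real m + 2) * ?p (Suc m) 1 = \<mu> * ?p m 1"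
      using legendre_deriv_at_1[of m n] by (simp add: \<mu>_def)
    have 2: "heine_const (Suc m) * (2 * real m + 2) = heine_const m * (real m + 1 / 2)"
      by (rule heine_const_Suc)
    have "(real m + 1 / 2) * ?p (Suc m) 1 * heine_const m = ?p m 1 * heine_const (Suc m) * \<mu>"
      using 1 2 by algebra
    then have "(real m + 1 / 2) * (C * ?p (Suc m) 1) * heine_const m = C * ?p m 1 * (heine_const (Suc m) * \<mu>)"
      by algebra
    then show ?thesis
      using \<mu> heine_const_pos[of m] heine_const_pos[of "Suc m"] by (simp add: frac_eq_eq)
  qed
  ultimately show ?case by (simp add: C_def)
qed

section \<open>The coefficients and terms of the kernel\<close>

text \<open>Coefficients of the Gauss series with parameters \<open>m/2 + 3/4\<close>,
  \<open>m/2 + 1/4\<close> and \<open>m + 1\<close>, as they arise in \<open>legendreQ\<close> for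
  \<open>nu = m - 1/2\<close> and \<open>mu = 0\<close>.\<close>

definition heine_coeff :: "nat \<Rightarrow> nat \<Rightarrow> real" where
  "heine_coeff m k = pochhammer (real m / 2 + 3 / 4) k * pochhammer (real m / 2 + 1 / 4) k
                       / (pochhammer (real m + 1) k * fact k)"

lemma heine_coeff_pos: "heine_coeff m k > 0"
  unfolding heine_coeff_def by (intro divide_pos_pos mult_pos_pos pochhammer_pos) auto

lemma heine_coeff_0 [simp]: "heine_coeff m 0 = 1"
  by (simp add: heine_coeff_def)

text \<open>The upper parameters differ by 1/2, so four times the product of their new factors is
  \<open>s (s + 1)\<close> with \<open>s = m + 1/2 + 2 k\<close>. That is the factor produced by two
  derivatives of \<open>D powr (- s)\<close>.\<close>

lemma heine_coeff_Suc:
  "heine_coeff m (Suc k) * (4 * (real k + 1) * (real m + 1 + real k))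
     = heine_coeff m k * ((real m + 1 / 2 + 2 * real k) * (real m + 1 / 2 + 2 * real k + 1))"
proof -
  have "heine_coeff m (Suc k) = heine_coeff m k * ((real m / 2 + 3 / 4 + k) * (real m / 2 + 1 / 4 + k)
           / ((real m + 1 + k) * (real k + 1)))"
    by (simp add: heine_coeff_def pochhammer_Suc algebra_simps)
  also have "\<dots> * (4 * (real k + 1) * (real m + 1 + real k))
     = heine_coeff m k * (4 * (real m / 2 + 3 / 4 + k) * (real m / 2 + 1 / 4 + k))"
    by (simp add: field_simps add_nonneg_eq_0_iff)
  finally show ?thesis by (simp add: algebra_simps)
qed

lemma summable_of_ratio_tendsto_1:
  fixes a :: "nat \<Rightarrow> real"
  assumes pos: "\<And>k. a k > 0" and lim: "(\<lambda>k. a (Suc k) / a k) \<longlonglongrightarrow> 1" and x: "0 \<le> x" "x < 1"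
  shows "summable (\<lambda>k. a k * x ^ k)"
proof -
  \<comment> \<open>The midpoint of \<open>x\<close> and 1 leaves room for the ratios, which tend to
    \<open>x\<close>.\<close>
  define q where "q = (1 + x) / 2"
  have "(\<lambda>k. a (Suc k) / a k * x) \<longlonglongrightarrow> 1 * x" by (intro tendsto_intros lim)
  moreover have "1 * x < q" using x by (simp add: q_def)
  ultimately have "eventually (\<lambda>k. a (Suc k) / a k * x < q) sequentially" by (rule order_tendstoD)
  then obtain N where N: "\<And>k. k \<ge> N \<Longrightarrow> a (Suc k) / a k * x < q"
    by (auto simp: eventually_sequentially)
  show ?thesis
  proof (rule summable_ratio_test)
    show "q < 1" using x by (simp add: q_def)
    fix k assume "N \<le> k"
    then have "a (Suc k) * x \<le> q * a k" using N[of k] pos[of k] by (simp add: field_simps)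
    then have "a (Suc k) * x * x ^ k \<le> q * a k * x ^ k" using x by (intro mult_right_mono) auto
    then show "norm (a (Suc k) * x ^ Suc k) \<le> q * norm (a k * x ^ k)"
      using pos[of k] pos[of "Suc k"] x by (simp add: abs_mult mult_ac)
  qed
qed

lemma heine_coeff_ratio: "heine_coeff m (Suc k) / heine_coeff m k
   = (real m + 1 / 2 + 2 * real k) * (real m + 1 / 2 + 2 * real k + 1) / (4 * (real k + 1) * (real m + 1 + real k))"
  using heine_coeff_Suc[of m k] heine_coeff_pos[of m k]
  by (subst frac_eq_eq) (auto simp: add_nonneg_eq_0_iff mult_ac)

lemma summable_heine_coeff:
  assumes "0 \<le> x" "x < 1" shows "summable (\<lambda>k. heine_coeff m k * x ^ k)"
proof (rule summable_of_ratio_tendsto_1[OF heine_coeff_pos _ assms])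
  show "(\<lambda>k. heine_coeff m (Suc k) / heine_coeff m k) \<longlonglongrightarrow> 1"
    unfolding heine_coeff_ratio by real_asymp
qed

text \<open>The coefficient of the single remainder that survives the telescoping in
  \<open>kterm_op_sum_antisym\<close>.\<close>

definition heine_coeff2 :: "nat \<Rightarrow> nat \<Rightarrow> real" where
  "heine_coeff2 m k = heine_coeff m k * ((real m + 1 / 2 + 2 * real k) * (real m + 1 / 2 + 2 * real k + 1))"

lemma summable_heine_coeff2:
  assumes "0 \<le> x" "x < 1" shows "summable (\<lambda>k. heine_coeff2 m k * x ^ k)"
proof (rule summable_of_ratio_tendsto_1[OF _ _ assms])
  show "heine_coeff2 m k > 0" for k
    unfolding heine_coeff2_def by (intro mult_pos_pos heine_coeff_pos) auto
  have "(\<lambda>k. heine_coeff2 m (Suc k) / heine_coeff2 m k) =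
     (\<lambda>k. (real m + 1 / 2 + 2 * real k) * (real m + 1 / 2 + 2 * real k + 1) / (4 * (real k + 1) * (real m + 1 + real k))
       * ((real m + 1 / 2 + 2 * real (Suc k)) * (real m + 1 / 2 + 2 * real (Suc k) + 1)
         / ((real m + 1 / 2 + 2 * real k) * (real m + 1 / 2 + 2 * real k + 1))))"
    unfolding heine_coeff2_def heine_coeff_ratio[symmetric] by simp
  also have "\<dots> \<longlonglongrightarrow> 1" by real_asymp
  finally show "(\<lambda>k. heine_coeff2 m (Suc k) / heine_coeff2 m k) \<longlonglongrightarrow> 1" .
qed

text \<open>The terms of the kernel with the powers of \<open>c - t * y\<close> merged into one, so
  that they can be differentiated as \<open>E^k * D powr (- s)\<close>.\<close>

definition kterm :: "nat \<Rightarrow> real \<Rightarrow> nat \<Rightarrow> real \<Rightarrow> real \<Rightarrow> real" where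
  "kterm m c k t y = ((1 - t\<^sup>2) * (1 - y\<^sup>2)) ^ k * (c - t * y) powr (- (real m + 1 / 2 + 2 * real k))"

text \<open>\<open>kterm1\<close> and \<open>kterm2\<close> are the first and second derivatives in
  \<open>t\<close>. The truncated exponents \<open>k - 1\<close> and \<open>k - 2\<close> do no
  harm, since such powers carry the factors \<open>real k\<close> and
  \<open>real k * real (k - 1)\<close>.\<close>

definition kterm1 :: "nat \<Rightarrow> real \<Rightarrow> nat \<Rightarrow> real \<Rightarrow> real \<Rightarrow> real" where
  "kterm1 m c k t y = (let E = (1 - t\<^sup>2) * (1 - y\<^sup>2); D = c - t * y; s = real m + 1 / 2 + 2 * real k in
     real k * E ^ (k - 1) * D powr (- s) * (- 2 * t * (1 - y\<^sup>2)) + s * E ^ k * D powr (- s - 1) * y)"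

definition kterm2 :: "nat \<Rightarrow> real \<Rightarrow> nat \<Rightarrow> real \<Rightarrow> real \<Rightarrow> real" where
  "kterm2 m c k t y = (let E = (1 - t\<^sup>2) * (1 - y\<^sup>2); D = c - t * y; s = real m + 1 / 2 + 2 * real k in
     real k * real (k - 1) * E ^ (k - 2) * D powr (- s) * (2 * t * (1 - y\<^sup>2))\<^sup>2
     - 4 * t * y * (1 - y\<^sup>2) * s * real k * E ^ (k - 1) * D powr (- s - 1)
     + y\<^sup>2 * s * (s + 1) * E ^ k * D powr (- s - 2)
     - 2 * (1 - y\<^sup>2) * real k * E ^ (k - 1) * D powr (- s))"

lemma deriv_E: "((\<lambda>t. ((1 - t\<^sup>2) * b) ^ j) has_real_derivative real j * ((1 - t\<^sup>2) * b) ^ (j - 1) * (- 2 * t * b)) (at t)"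
  for t b :: real
  by (auto intro!: derivative_eq_intros)

lemma deriv_D: "c - t * y > 0 \<Longrightarrow>
  ((\<lambda>t. (c - t * y) powr a) has_real_derivative (- a) * (c - t * y) powr (a - 1) * y) (at t)" for t y a c :: real
  using DERIV_fun_powr[of "\<lambda>t. c - t * y" "- y" t a] by (auto intro!: derivative_eq_intros)

lemma kterm_deriv:
  assumes "c - t * y > 0"
  shows "((\<lambda>t. kterm m c k t y) has_real_derivative kterm1 m c k t y) (at t)"
  unfolding kterm_def kterm1_def Let_def
  by (rule DERIV_cong[OF DERIV_mult[OF deriv_E deriv_D[OF assms]]]) (simp add: algebra_simps)

lemma kterm1_deriv:
  assumes "c - t * y > 0"
  shows "((\<lambda>t. kterm1 m c k t y) has_real_derivative kterm2 m c k t y) (at t)"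
proof -
  have aux: "((\<lambda>t. - 2 * t * (1 - y\<^sup>2)) has_real_derivative - 2 * (1 - y\<^sup>2)) (at t)"
    by (auto intro!: derivative_eq_intros)
  \<comment> \<open>Naming the powers makes them atoms, so that the two forms of the second
    derivative are compared as polynomials.\<close>
  define s where "s = real m + 1 / 2 + 2 * real k"
  define E1 where "E1 = ((1 - t\<^sup>2) * (1 - y\<^sup>2)) ^ (k - 2)"
  define E2 where "E2 = ((1 - t\<^sup>2) * (1 - y\<^sup>2)) ^ (k - 1)"
  define E3 where "E3 = ((1 - t\<^sup>2) * (1 - y\<^sup>2)) ^ k"
  define D1 where "D1 = (c - t * y) powr (- s)"
  define D2 where "D2 = (c - t * y) powr (- s - 1)"
  define D3 where "D3 = (c - t * y) powr (- s - 2)"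
  have e: "- s - 1 - 1 = - s - 2" "k - 1 - 1 = k - 2" by simp_all
  show ?thesis
    unfolding kterm1_def kterm2_def Let_def s_def[symmetric]
  proof (rule DERIV_cong[OF DERIV_add[OF DERIV_mult[OF DERIV_mult[OF DERIV_cmult[OF deriv_E] deriv_D[OF assms]] aux]
              DERIV_cmult_right[OF DERIV_mult[OF DERIV_cmult[OF deriv_E] deriv_D[OF assms]]]]],
         unfold e, unfold E1_def[symmetric] E2_def[symmetric] E3_def[symmetric] D1_def[symmetric] D2_def[symmetric] D3_def[symmetric])
  qed (simp add: power2_eq_square algebra_simps)
qed

text \<open>The Gegenbauer operator in the first variable applied to a term. As \<open>kterm\<close>
  is symmetric, exchanging \<open>t\<close> and \<open>y\<close> gives the operator in the second
  variable.\<close>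

definition kterm_op :: "nat \<Rightarrow> real \<Rightarrow> nat \<Rightarrow> real \<Rightarrow> real \<Rightarrow> real" where
  "kterm_op m c k t y = (1 - t\<^sup>2) * kterm2 m c k t y - (2 * real m + 2) * t * kterm1 m c k t y"

text \<open>Up to the factor \<open>s (s + 1)\<close>, the second derivative of
  \<open>E^k * D powr (- s)\<close> with respect to \<open>D\<close>.\<close>

definition kerr :: "nat \<Rightarrow> real \<Rightarrow> nat \<Rightarrow> real \<Rightarrow> real \<Rightarrow> real" where
  "kerr m c k t y = ((1 - t\<^sup>2) * (1 - y\<^sup>2)) ^ k * (c - t * y) powr (- (real m + 1 / 2 + 2 * real k) - 2)"

text \<open>In the variables \<open>E = (1 - t\<^sup>2) * (1 - y\<^sup>2)\<close> and \<open>D = c - t * y\<close> the difference of the Gegenbauer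
  operators in \<open>t\<close> and in \<open>y\<close> is \<open>(t\<^sup>2 - y\<^sup>2)\<close> times \<open>4 * E * \<partial>\<^sub>E\<^sup>2 + (4 * m + 4) * \<partial>\<^sub>E - \<partial>\<^sub>D\<^sup>2\<close>;
  the recurrence of the coefficients makes consecutive terms cancel.\<close>

lemma kterm_op_antisym_0:
  "kterm_op m c 0 t y - kterm_op m c 0 y t
     = (y\<^sup>2 - t\<^sup>2) * ((real m + 1 / 2) * (real m + 1 / 2 + 1)) * kerr m c 0 t y"
proof -
  define s where "s = real m + 1 / 2"
  define D2 where "D2 = (c - t * y) powr (- s - 1)"
  define D3 where "D3 = (c - t * y) powr (- s - 2)"
  have c: "y * t = t * y" by simp
  have z: "real m + 1 / 2 + 2 * real 0 = s" by (simp add: s_def)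
  show ?thesis
    unfolding kterm_op_def kterm1_def kterm2_def kerr_def Let_def c z s_def[symmetric] D2_def[symmetric] D3_def[symmetric]
    by (simp add: power2_eq_square algebra_simps)
qed

lemma kterm_op_antisym_Suc:
  "kterm_op m c (Suc k) t y - kterm_op m c (Suc k) y t
     = (y\<^sup>2 - t\<^sup>2) * ((real m + 1 / 2 + 2 * real (Suc k)) * (real m + 1 / 2 + 2 * real (Suc k) + 1) * kerr m c (Suc k) t y
         - 4 * (real k + 1) * (real m + 1 + real k) * kerr m c k t y)"
proof -
  define s where "s = real m + 1 / 2 + 2 * real (Suc k)"
  define u where "u = real k"
  define A where "A = 1 - t\<^sup>2"
  define B where "B = 1 - y\<^sup>2"
  define D1 where "D1 = (c - t * y) powr (- s)"
  define D2 where "D2 = (c - t * y) powr (- s - 1)"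
  define D3 where "D3 = (c - t * y) powr (- s - 2)"
  define e where "e = (A * B) ^ (k - 1)"
  have c: "y * t = t * y" "B * A = A * B" by simp_all
  \<comment> \<open>The exponent of \<open>D\<close> in \<open>kerr\<close> of index
    \<open>k\<close> is that of \<open>kterm\<close> of index \<open>Suc k\<close>. This shift is
    what lets neighbouring terms cancel.\<close>
  have z: "- (real m + 1 / 2 + 2 * real k) - 2 = - s" by (simp add: s_def)
  have z2: "Suc k - 1 = k" "Suc k - 2 = k - 1" by simp_all
  have s: "real (Suc k) = u + 1" by (simp add: u_def)
  \<comment> \<open>The factor \<open>u\<close> covers \<open>k = 0\<close>, where the truncated
    exponent \<open>k - 1\<close> would be wrong: both sides are then zero.\<close>
  have e: "u * (A * B) ^ k = u * (A * B * e)" unfolding u_def e_def by (cases k) auto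
  define f where "f = (A * B) ^ k"
  have f: "(A * B) ^ Suc k = A * B * f" by (simp add: f_def)
  have A: "t\<^sup>2 = 1 - A" "y\<^sup>2 = 1 - B" by (simp_all add: A_def B_def)
  have "kterm_op m c (Suc k) t y - kterm_op m c (Suc k) y t
     = (y\<^sup>2 - t\<^sup>2) * (s * (s + 1) * (A * B * f) * D3 - 4 * (u + 1) * (u * (A * B * e)) * D1
           - 2 * (2 * real m + 2) * (u + 1) * f * D1)"
    unfolding kterm_op_def kterm1_def kterm2_def kerr_def Let_def A_def[symmetric] B_def[symmetric] c z2
    unfolding s_def[symmetric] D1_def[symmetric] D2_def[symmetric] D3_def[symmetric] e_def[symmetric] f_def[symmetric] f
    unfolding s u_def[symmetric]
    using A by algebra
  also have "\<dots> = (y\<^sup>2 - t\<^sup>2) * (s * (s + 1) * ((A * B * f) * D3) - 4 * (u + 1) * (real m + 1 + u) * (f * D1))"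
    unfolding e[symmetric] f_def by algebra
  finally show ?thesis
    unfolding kerr_def z
    unfolding A_def[symmetric] B_def[symmetric] f s_def[symmetric] D1_def[symmetric] D3_def[symmetric]
      f_def[symmetric] u_def[symmetric] .
qed

text \<open>By \<open>heine_coeff_Suc\<close> the sum telescopes to its top error term. For
  \<open>c > 1\<close> that term tends to zero uniformly on the square.\<close>

lemma kterm_op_sum_antisym:
  "(\<Sum>k\<le>N. heine_coeff m k * (kterm_op m c k t y - kterm_op m c k y t))
     = (y\<^sup>2 - t\<^sup>2) * (heine_coeff2 m N * kerr m c N t y)"
proof (induction N)
  case 0
  show ?case by (simp add: kterm_op_antisym_0 heine_coeff2_def)
next
  case (Suc N)
  have "heine_coeff m (Suc N) * (kterm_op m c (Suc N) t y - kterm_op m c (Suc N) y t)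
    = (y\<^sup>2 - t\<^sup>2) * (heine_coeff2 m (Suc N) * kerr m c (Suc N) t y
         - heine_coeff m (Suc N) * (4 * (real N + 1) * (real m + 1 + real N)) * kerr m c N t y)"
    unfolding kterm_op_antisym_Suc heine_coeff2_def by algebra
  then show ?case
    unfolding sum.atMost_Suc Suc heine_coeff_Suc heine_coeff2_def[symmetric] by (simp add: algebra_simps)
qed

section \<open>Self-adjointness of the Gegenbauer operator\<close>

text \<open>The two derivatives of the function are arguments, so that the operator is a pointwise
  expression without any choice of derivative.\<close>

definition gegenbauer_op :: "nat \<Rightarrow> (real \<Rightarrow> real) \<Rightarrow> (real \<Rightarrow> real) \<Rightarrow> real \<Rightarrow> real" where
  "gegenbauer_op m u1 u2 t = (1 - t\<^sup>2) * u2 t - (2 * real m + 2) * t * u1 t"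

text \<open>Lagrange's identity: the integrand is the derivative of
  \<open>(1 - t^2)^(m + 1) * (u' v - u v')\<close>, and the weight kills the boundary terms.\<close>

lemma gegenbauer_op_selfadjoint:
  assumes u: "\<And>t. t \<in> {-1..1} \<Longrightarrow> (u has_real_derivative u1 t) (at t)"
             "\<And>t. t \<in> {-1..1} \<Longrightarrow> (u1 has_real_derivative u2 t) (at t)"
      and v: "\<And>t. t \<in> {-1..1} \<Longrightarrow> (v has_real_derivative v1 t) (at t)"
             "\<And>t. t \<in> {-1..1} \<Longrightarrow> (v1 has_real_derivative v2 t) (at t)"
  shows "((\<lambda>t. (1 - t\<^sup>2) ^ m * gegenbauer_op m u1 u2 t * v t
             - (1 - t\<^sup>2) ^ m * u t * gegenbauer_op m v1 v2 t) has_integral 0) {-1..1}"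
proof -
  have "((\<lambda>t. (1 - t\<^sup>2) ^ m * gegenbauer_op m u1 u2 t * v t
             - (1 - t\<^sup>2) ^ m * u t * gegenbauer_op m v1 v2 t) has_integral
     (1 - 1\<^sup>2) ^ Suc m * (u1 1 * v 1 - u 1 * v1 1)
       - (1 - (- 1)\<^sup>2) ^ Suc m * (u1 (- 1) * v (- 1) - u (- 1) * v1 (- 1))) {-1..1}"
  proof (rule fundamental_theorem_of_calculus)
    fix t :: real assume t: "t \<in> {-1..1}"
    have "((\<lambda>t. (1 - t\<^sup>2) ^ Suc m * (u1 t * v t - u t * v1 t)) has_real_derivative
        - (2 * real m + 2) * t * (1 - t\<^sup>2) ^ m * (u1 t * v t - u t * v1 t)
        + ((u2 t * v t + v1 t * u1 t) - (u1 t * v1 t + v2 t * u t)) * (1 - t\<^sup>2) ^ Suc m) (at t)"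
      by (intro DERIV_mult DERIV_diff one_minus_square_power_deriv u v t)
    also have "- (2 * real m + 2) * t * (1 - t\<^sup>2) ^ m * (u1 t * v t - u t * v1 t)
        + ((u2 t * v t + v1 t * u1 t) - (u1 t * v1 t + v2 t * u t)) * (1 - t\<^sup>2) ^ Suc m
       = (1 - t\<^sup>2) ^ m * gegenbauer_op m u1 u2 t * v t - (1 - t\<^sup>2) ^ m * u t * gegenbauer_op m v1 v2 t"
      unfolding gegenbauer_op_def power_Suc by algebra
    finally show "((\<lambda>t. (1 - t\<^sup>2) ^ Suc m * (u1 t * v t - u t * v1 t)) has_vector_derivative
       (1 - t\<^sup>2) ^ m * gegenbauer_op m u1 u2 t * v t - (1 - t\<^sup>2) ^ m * u t * gegenbauer_op m v1 v2 t)
       (at t within {-1..1})"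
      by (simp only: has_real_derivative_iff_has_vector_derivative has_vector_derivative_at_within)
  qed simp
  then show ?thesis by simp
qed

section \<open>Continuous functions and iterated integrals on the square\<close>

lemma continuous_on_box_integral:
  fixes f :: "real \<Rightarrow> real \<Rightarrow> real"
  assumes "continuous_on ({-1..1} \<times> {-1..1}) (\<lambda>z. f (fst z) (snd z))"
  shows "continuous_on {-1..1} (\<lambda>x. integral {-1..1} (f x))"
  using integral_continuous_on_param[of "{-1..1}" "-1" 1 f] assms by (simp add: case_prod_beta)

lemma integral_swap_box:
  fixes f :: "real \<Rightarrow> real \<Rightarrow> real"
  assumes "continuous_on ({-1..1} \<times> {-1..1}) (\<lambda>z. f (fst z) (snd z))"
  shows "integral {-1..1} (\<lambda>x. integral {-1..1} (\<lambda>y. f x y)) = integral {-1..1} (\<lambda>y. integral {-1..1} (\<lambda>x. f x y))"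
  using integral_swap_continuous[of "-1" "-1" 1 1 f] assms
  by (simp add: case_prod_beta cbox_Pair_eq)

lemma continuous_on_box_fst: "continuous_on {-1..1} f \<Longrightarrow> continuous_on ({-1..1::real} \<times> {-1..1::real}) (\<lambda>z. f (fst z))"
  for f :: "real \<Rightarrow> real"
  by (erule continuous_on_compose2[of "{-1..1}" f]) (auto intro: continuous_intros)

lemma continuous_on_box_snd: "continuous_on {-1..1} f \<Longrightarrow> continuous_on ({-1..1::real} \<times> {-1..1::real}) (\<lambda>z. f (snd z))"
  for f :: "real \<Rightarrow> real"
  by (erule continuous_on_compose2[of "{-1..1}" f]) (auto intro: continuous_intros)

lemma continuous_on_box_swap:
  "continuous_on ({-1..1} \<times> {-1..1}) (\<lambda>z. f (fst z) (snd z)) \<Longrightarrow>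
   continuous_on ({-1..1} \<times> {-1..1}) (\<lambda>z. f (snd z) (fst z))" for f :: "real \<Rightarrow> real \<Rightarrow> real"
  by (erule continuous_on_compose2[of "{-1..1} \<times> {-1..1}" "\<lambda>z. f (fst z) (snd z)" _ "\<lambda>z. (snd z, fst z)", simplified])
     (auto intro!: continuous_intros)

lemma continuous_on_box_slice:
  "continuous_on ({-1..1} \<times> {-1..1}) (\<lambda>z. f (fst z) (snd z)) \<Longrightarrow> y \<in> {-1..1} \<Longrightarrow>
   continuous_on {-1..1} (\<lambda>t. f t y)" for f :: "real \<Rightarrow> real \<Rightarrow> real"
  by (erule continuous_on_compose2[of "{-1..1} \<times> {-1..1}" "\<lambda>z. f (fst z) (snd z)" _ "\<lambda>t. (t, y)", simplified])
     (auto intro!: continuous_intros)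

lemma integral_bound_interval:
  fixes f :: "real \<Rightarrow> real"
  assumes "continuous_on {-1..1} f" "\<And>t. t \<in> {-1..1} \<Longrightarrow> \<bar>f t\<bar> \<le> B"
  shows "\<bar>integral {-1..1} f\<bar> \<le> 2 * B"
  using integral_bound[of "-1" 1 f B] assms by (simp add: mult.commute)

lemma weight_bounds: "t \<in> {-1..1} \<Longrightarrow> 0 \<le> (1 - t\<^sup>2) ^ m \<and> (1 - t\<^sup>2) ^ m \<le> (1::real)" for t :: real
proof -
  assume "t \<in> {-1..1}"
  then have "t\<^sup>2 \<le> 1" by (simp add: abs_square_le_1 abs_le_iff)
  then show ?thesis by (auto intro!: power_le_one)
qed

text \<open>Self-adjointness moves the operator from \<open>q\<close> onto \<open>S\<close> in the
  variable \<open>y\<close>, and replaces \<open>\<mu> * p\<close> by minus the operator acting on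
  \<open>S\<close> in the variable \<open>t\<close>. What is left is the double integral of the
  difference of the two, which is at most \<open>\<epsilon>\<close> on a square of area 4.\<close>

lemma gegenbauer_almost_commuting_kernel:
  fixes S S1 S2 :: "real \<Rightarrow> real \<Rightarrow> real" and p p1 p2 q q1 q2 :: "real \<Rightarrow> real" and m :: nat
  defines "LS \<equiv> \<lambda>t y. gegenbauer_op m (\<lambda>t. S1 t y) (\<lambda>t. S2 t y) t"
  assumes sym: "\<And>t y. S t y = S y t"
    and S1: "\<And>t y. t \<in> {-1..1} \<Longrightarrow> y \<in> {-1..1} \<Longrightarrow> ((\<lambda>t. S t y) has_real_derivative S1 t y) (at t)"
    and S2: "\<And>t y. t \<in> {-1..1} \<Longrightarrow> y \<in> {-1..1} \<Longrightarrow> ((\<lambda>t. S1 t y) has_real_derivative S2 t y) (at t)"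
    and contS: "continuous_on ({-1..1} \<times> {-1..1}) (\<lambda>z. S (fst z) (snd z))"
    and contLS: "continuous_on ({-1..1} \<times> {-1..1}) (\<lambda>z. LS (fst z) (snd z))"
    and p: "\<And>t. (p has_real_derivative p1 t) (at t)" "\<And>t. (p1 has_real_derivative p2 t) (at t)"
    and eig: "\<And>t. gegenbauer_op m p1 p2 t = - \<mu> * p t"
    and q: "\<And>t. (q has_real_derivative q1 t) (at t)" "\<And>t. (q1 has_real_derivative q2 t) (at t)"
    and cq: "continuous_on {-1..1} q2"
    and comm: "\<And>t y. t \<in> {-1..1} \<Longrightarrow> y \<in> {-1..1} \<Longrightarrow> \<bar>LS t y - LS y t\<bar> \<le> \<epsilon>"
    and P: "\<And>t. t \<in> {-1..1} \<Longrightarrow> \<bar>p t\<bar> \<le> P" and Q: "\<And>t. t \<in> {-1..1} \<Longrightarrow> \<bar>q t\<bar> \<le> Q"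
  shows "\<bar>integral {-1..1} (\<lambda>y. (1 - y\<^sup>2) ^ m * (gegenbauer_op m q1 q2 y + \<mu> * q y) *
              integral {-1..1} (\<lambda>t. (1 - t\<^sup>2) ^ m * p t * S t y))\<bar> \<le> 4 * P * Q * \<epsilon>"
proof -
  define w where "w t = (1 - t\<^sup>2) ^ m" for t :: real
  define Lq where "Lq = gegenbauer_op m q1 q2"
  define J where "J = {-1..1::real}"
  have cw: "continuous_on J w" unfolding w_def by (intro continuous_intros)
  have cp: "continuous_on J p" and cq0: "continuous_on J q" and cq1: "continuous_on J q1"
    by (rule DERIV_continuous_on[OF has_field_derivative_at_within], rule p q)+
  have cLq: "continuous_on J Lq"
    unfolding Lq_def gegenbauer_op_def[abs_def] by (intro continuous_intros cq[folded J_def] cq1)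
  note box = continuous_on_box_fst[folded J_def] continuous_on_box_snd[folded J_def]
     continuous_on_box_swap[folded J_def]
  note contS = contS[folded J_def] and contLS = contLS[folded J_def]
  note slice = continuous_on_box_slice[folded J_def]
  note swap = integral_swap_box[folded J_def]
  note cint = continuous_on_box_integral[folded J_def]
  have intble: "f integrable_on J" if "continuous_on J f" for f :: "real \<Rightarrow> real"
    using that unfolding J_def by (rule integrable_continuous_real)
  \<comment> \<open>Self-adjointness in \<open>t\<close>, with the eigenvalue equation for
    \<open>p\<close>.\<close>
  have adj_p: "- \<mu> * integral J (\<lambda>t. w t * p t * S t y) = integral J (\<lambda>t. w t * p t * LS t y)" if y: "y \<in> J" for y
  proof -
    have "((\<lambda>t. w t * gegenbauer_op m p1 p2 t * S t y - w t * p t * LS t y) has_integral 0) J"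
      unfolding LS_def w_def J_def using y
      by (intro gegenbauer_op_selfadjoint p S1 S2) (auto simp: J_def)
    then have "integral J (\<lambda>t. - \<mu> * (w t * p t * S t y) - w t * p t * LS t y) = 0"
      unfolding eig by (simp add: integral_unique mult_ac)
    moreover have "integral J (\<lambda>t. - \<mu> * (w t * p t * S t y) - w t * p t * LS t y)
        = integral J (\<lambda>t. - \<mu> * (w t * p t * S t y)) - integral J (\<lambda>t. w t * p t * LS t y)"
      by (intro integral_diff intble continuous_intros cw cp slice[OF contS y] slice[OF contLS y])
    ultimately show ?thesis by simp
  qed
  \<comment> \<open>Self-adjointness in \<open>y\<close>; the symmetry of \<open>S\<close> turns the
    operator in the second slot into \<open>LS y t\<close>.\<close>
  have adj_q: "integral J (\<lambda>y. w y * Lq y * S t y) = integral J (\<lambda>y. w y * q y * LS y t)" if t: "t \<in> J" for t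
  proof -
    have "((\<lambda>y. w y * Lq y * S y t - w y * q y * LS y t) has_integral 0) J"
      unfolding LS_def w_def J_def Lq_def using t
      by (intro gegenbauer_op_selfadjoint q S1 S2) (auto simp: J_def)
    moreover have "integral J (\<lambda>y. w y * Lq y * S y t - w y * q y * LS y t)
        = integral J (\<lambda>y. w y * Lq y * S y t) - integral J (\<lambda>y. w y * q y * LS y t)"
      by (intro integral_diff intble continuous_intros cw cq0 cLq slice[OF contS t] slice[OF contLS t])
    ultimately show ?thesis by (simp add: integral_unique sym[of t])
  qed
  note cb = box(1)[OF cw] box(2)[OF cw] box(1)[OF cp] box(2)[OF cp] box(1)[OF cq0] box(2)[OF cq0]
     box(1)[OF cLq] box(2)[OF cLq] contS box(3)[OF contS] contLS box(3)[OF contLS]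
  define F where "F y = integral J (\<lambda>t. w t * p t * S t y)" for y
  have cF: "continuous_on J F"
    unfolding F_def
    by (rule cint, intro continuous_intros cb)
  \<comment> \<open>Fubini's theorem puts the \<open>y\<close>-integral inside, where
    \<open>adj_q\<close> applies, and a second exchange restores the order.\<close>
  have A: "integral J (\<lambda>y. w y * Lq y * F y)
      = integral J (\<lambda>y. integral J (\<lambda>t. w y * q y * w t * p t * LS y t))"
  proof -
    have "integral J (\<lambda>y. w y * Lq y * F y) = integral J (\<lambda>y. integral J (\<lambda>t. w y * Lq y * (w t * p t * S t y)))"
      unfolding F_def by simp
    also have "\<dots> = integral J (\<lambda>t. integral J (\<lambda>y. w y * Lq y * (w t * p t * S t y)))"
      by (rule swap, intro continuous_intros cb)
    also have "\<dots> = integral J (\<lambda>t. w t * p t * integral J (\<lambda>y. w y * Lq y * S t y))"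
      by (simp add: mult_ac flip: integral_mult_right)
    also have "\<dots> = integral J (\<lambda>t. w t * p t * integral J (\<lambda>y. w y * q y * LS y t))"
      by (rule integral_cong) (simp add: adj_q)
    also have "\<dots> = integral J (\<lambda>t. integral J (\<lambda>y. w y * q y * w t * p t * LS y t))"
      by (simp add: mult_ac flip: integral_mult_right)
    also have "\<dots> = integral J (\<lambda>y. integral J (\<lambda>t. w y * q y * w t * p t * LS y t))"
      by (rule swap, intro continuous_intros cb)
    finally show ?thesis .
  qed
  have B: "integral J (\<lambda>y. w y * (\<mu> * q y) * F y)
      = integral J (\<lambda>y. - integral J (\<lambda>t. w y * q y * w t * p t * LS t y))"
  proof (rule integral_cong)
    fix y assume y: "y \<in> J"
    have "w y * (\<mu> * q y) * F y = - (w y * q y * (- \<mu> * F y))" by simp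
    also have "\<dots> = - integral J (\<lambda>t. w y * q y * (w t * p t * LS t y))"
      unfolding F_def adj_p[OF y] by simp
    finally show "w y * (\<mu> * q y) * F y = - integral J (\<lambda>t. w y * q y * w t * p t * LS t y)"
      by (simp add: mult_ac)
  qed
  have cA: "continuous_on J (\<lambda>y. integral J (\<lambda>t. w y * q y * w t * p t * LS y t))"
    by (rule cint, intro continuous_intros cb)
  have cB: "continuous_on J (\<lambda>y. integral J (\<lambda>t. w y * q y * w t * p t * LS t y))"
    by (rule cint, intro continuous_intros cb)
  have "integral J (\<lambda>y. w y * (Lq y + \<mu> * q y) * F y) = integral J (\<lambda>y. w y * Lq y * F y + w y * (\<mu> * q y) * F y)"
    by (simp add: algebra_simps)
  also have "\<dots> = integral J (\<lambda>y. w y * Lq y * F y) + integral J (\<lambda>y. w y * (\<mu> * q y) * F y)"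
    by (intro integral_add intble continuous_intros cw cLq cF cq0)
  also have "\<dots> = integral J (\<lambda>y. integral J (\<lambda>t. w y * q y * w t * p t * LS y t)
                 + - integral J (\<lambda>t. w y * q y * w t * p t * LS t y))"
    unfolding A B by (intro integral_add[symmetric] intble cA continuous_on_minus cB)
  \<comment> \<open>Each factor 2 is the length of the interval of one of the integrals; the weights
    are at most 1.\<close>
  also have "\<bar>\<dots>\<bar> \<le> 2 * (2 * (P * Q * \<epsilon>))"
    unfolding J_def
  proof (rule integral_bound_interval, unfold J_def[symmetric])
    show "continuous_on J (\<lambda>y. integral J (\<lambda>t. w y * q y * w t * p t * LS y t)
                 + - integral J (\<lambda>t. w y * q y * w t * p t * LS t y))"
      by (intro continuous_intros cA cB)
    fix y assume y: "y \<in> J"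
    have c1: "continuous_on J (\<lambda>t. w y * q y * w t * p t * LS y t)"
      by (intro continuous_intros cw cp slice[OF box(3)[OF contLS] y])
    have c2: "continuous_on J (\<lambda>t. w y * q y * w t * p t * LS t y)"
      by (intro continuous_intros cw cp slice[OF contLS y])
    have "integral J (\<lambda>t. w y * q y * w t * p t * LS y t) + - integral J (\<lambda>t. w y * q y * w t * p t * LS t y)
       = integral J (\<lambda>t. w y * q y * w t * p t * LS y t - w y * q y * w t * p t * LS t y)"
      by (simp add: integral_diff[OF intble[OF c1] intble[OF c2]])
    also have "\<bar>\<dots>\<bar> \<le> 2 * (P * Q * \<epsilon>)"
      unfolding J_def
    proof (rule integral_bound_interval, unfold J_def[symmetric])
      show "continuous_on J (\<lambda>t. w y * q y * w t * p t * LS y t - w y * q y * w t * p t * LS t y)"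
        by (intro continuous_intros c1 c2)
      fix t assume t: "t \<in> J"
      have w: "\<bar>w y\<bar> \<le> 1" "\<bar>w t\<bar> \<le> 1"
        using weight_bounds[of t m] weight_bounds[of y m] t y by (auto simp: w_def J_def)
      have "\<bar>w y * q y * w t * p t * LS y t - w y * q y * w t * p t * LS t y\<bar>
          = \<bar>w y\<bar> * \<bar>w t\<bar> * (\<bar>p t\<bar> * \<bar>q y\<bar> * \<bar>LS y t - LS t y\<bar>)"
        unfolding abs_mult[symmetric] by (simp add: algebra_simps)
      also have "\<dots> \<le> 1 * 1 * (P * Q * \<epsilon>)"
        using w t y P[of t] Q[of y] comm[of y t]
        by (intro mult_mono) (auto simp: J_def intro: order_trans[OF abs_ge_zero])
      finally show "\<bar>w y * q y * w t * p t * LS y t - w y * q y * w t * p t * LS t y\<bar> \<le> P * Q * \<epsilon>" by simp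
    qed
    finally show "\<bar>integral J (\<lambda>t. w y * q y * w t * p t * LS y t)
                 + - integral J (\<lambda>t. w y * q y * w t * p t * LS t y)\<bar> \<le> 2 * (P * Q * \<epsilon>)" .
  qed
  finally show ?thesis
    unfolding F_def w_def Lq_def J_def by (simp add: mult_ac)
qed

section \<open>The kernel\<close>

definition heine_series :: "nat \<Rightarrow> real \<Rightarrow> real" where
  "heine_series m x = (\<Sum>k. heine_coeff m k * x ^ k)"

text \<open>With \<open>t = cos \<theta>\<close> and \<open>y = cos \<theta>'\<close> this is
  \<open>Q_(m - 1/2)\<close> at \<open>(c - t y) / (sin \<theta> sin \<theta>')\<close>, divided by
  \<open>heine_const m\<close> and by the power \<open>m + 1/2\<close> of the product of the
  sines.\<close>

definition heine_kernel :: "nat \<Rightarrow> real \<Rightarrow> real \<Rightarrow> real \<Rightarrow> real" where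
  "heine_kernel m c t y = (c - t * y) powr (- (real m + 1 / 2))
     * heine_series m ((1 - t\<^sup>2) * (1 - y\<^sup>2) / (c - t * y)\<^sup>2)"

lemma heine_series_0 [simp]: "heine_series m 0 = 1"
  unfolding heine_series_def by (subst powser_zero) simp

lemma heine_series_mono:
  assumes "0 \<le> x" "x \<le> x'" "x' < 1" shows "heine_series m x \<le> heine_series m x'"
  unfolding heine_series_def using assms heine_coeff_pos[of m]
  by (intro suminf_le summable_heine_coeff mult_left_mono power_mono) (auto intro: less_imp_le)

lemma heine_series_nonneg: "0 \<le> x \<Longrightarrow> x < 1 \<Longrightarrow> 0 \<le> heine_series m x"
  using heine_series_mono[of 0 x m] by simp

lemma isCont_heine_series: assumes "0 \<le> x" "x < 1" shows "isCont (heine_series m) x"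
proof -
  have "isCont (\<lambda>x. \<Sum>k. heine_coeff m k * x ^ k) x"
    by (rule isCont_powser[OF summable_heine_coeff[of "(x + 1) / 2"]]) (use assms in auto)
  then show ?thesis unfolding heine_series_def[abs_def] .
qed

text \<open>With \<open>a = \<bar>t y\<bar>\<close> one has \<open>(1 - a)^2 - (1 - t^2)(1 - y^2) =
  (\<bar>t\<bar> - \<bar>y\<bar>)^2\<close>, while \<open>(1 - a) c \<le> c - a\<close> because
  \<open>c \<ge> 1\<close>. For \<open>c > 1\<close> this keeps the argument of the series at most
  \<open>1 / c^2\<close>, which gives uniform convergence on the square.\<close>

lemma kernel_argument_bounds:
  fixes c t y :: real
  assumes "c \<ge> 1" "t \<in> {-1..1}" "y \<in> {-1..1}"
  shows "c - t * y \<ge> c - 1" "(1 - t\<^sup>2) * (1 - y\<^sup>2) \<ge> 0" "(1 - t\<^sup>2) * (1 - y\<^sup>2) * c\<^sup>2 \<le> (c - t * y)\<^sup>2"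
proof -
  define a where "a = \<bar>t\<bar> * \<bar>y\<bar>"
  have ty: "\<bar>t\<bar> \<le> 1" "\<bar>y\<bar> \<le> 1" using assms by auto
  then have a: "0 \<le> a" "a \<le> 1" unfolding a_def by (auto intro: mult_le_one)
  have "t * y \<le> a" using abs_ge_self[of "t * y"] by (simp add: a_def abs_mult)
  then show "c - t * y \<ge> c - 1" using a by simp
  show "(1 - t\<^sup>2) * (1 - y\<^sup>2) \<ge> 0" using ty by (intro mult_nonneg_nonneg) (auto simp: abs_square_le_1)
  have "(1 - a)\<^sup>2 - (1 - t\<^sup>2) * (1 - y\<^sup>2) = (\<bar>t\<bar> - \<bar>y\<bar>)\<^sup>2"
    by (simp add: a_def power2_eq_square algebra_simps)
  then have "(1 - t\<^sup>2) * (1 - y\<^sup>2) \<le> (1 - a)\<^sup>2" by (smt (verit) zero_le_power2)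
  then have "(1 - t\<^sup>2) * (1 - y\<^sup>2) * c\<^sup>2 \<le> (1 - a)\<^sup>2 * c\<^sup>2" by (intro mult_right_mono) auto
  also have "\<dots> = ((1 - a) * c)\<^sup>2" by (simp add: power_mult_distrib)
  also have "\<dots> \<le> (c - t * y)\<^sup>2"
  proof (rule power_mono)
    have "a \<le> a * c" using a assms(1) mult_left_mono[of 1 c a] by simp
    then show "(1 - a) * c \<le> c - t * y" using \<open>t * y \<le> a\<close> by (simp add: algebra_simps)
    show "0 \<le> (1 - a) * c" using a assms(1) by simp
  qed
  finally show "(1 - t\<^sup>2) * (1 - y\<^sup>2) * c\<^sup>2 \<le> (c - t * y)\<^sup>2" .
qed

lemma kernel_ratio_bounds:
  fixes c t y :: real
  assumes "c > 1" "t \<in> {-1..1}" "y \<in> {-1..1}"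
  shows "0 \<le> (1 - t\<^sup>2) * (1 - y\<^sup>2) / (c - t * y)\<^sup>2" "(1 - t\<^sup>2) * (1 - y\<^sup>2) / (c - t * y)\<^sup>2 \<le> 1 / c\<^sup>2"
proof -
  note b = kernel_argument_bounds[of c t y]
  have "c - t * y > 0" using b(1) assms by simp
  then show "0 \<le> (1 - t\<^sup>2) * (1 - y\<^sup>2) / (c - t * y)\<^sup>2" "(1 - t\<^sup>2) * (1 - y\<^sup>2) / (c - t * y)\<^sup>2 \<le> 1 / c\<^sup>2"
    using b(2,3) assms by (simp_all add: divide_le_eq pos_le_divide_eq)
qed

lemma kterm_eq:
  assumes "c - t * y > 0"
  shows "kterm m c k t y = (c - t * y) powr (- (real m + 1 / 2)) * ((1 - t\<^sup>2) * (1 - y\<^sup>2) / (c - t * y)\<^sup>2) ^ k"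
    and "kerr m c k t y = (c - t * y) powr (- (real m + 1 / 2) - 2) * ((1 - t\<^sup>2) * (1 - y\<^sup>2) / (c - t * y)\<^sup>2) ^ k"
proof -
  define D where "D = c - t * y"
  have D: "D > 0" using assms by (simp add: D_def)
  have e: "- (real m + 1 / 2 + 2 * real k) = - (real m + 1 / 2) + - real (2 * k)"
          "- (real m + 1 / 2 + 2 * real k) - 2 = (- (real m + 1 / 2) - 2) + - real (2 * k)" by simp_all
  have pw: "D powr (a + - real (2 * k)) = D powr a * (1 / (D\<^sup>2) ^ k)" for a
  proof -
    have "D powr (- real (2 * k)) = 1 / (D\<^sup>2) ^ k"
      unfolding powr_minus_divide powr_realpow[OF D] by (simp add: power_mult)
    then show ?thesis by (simp only: powr_add)
  qed
  show "kterm m c k t y = (c - t * y) powr (- (real m + 1 / 2)) * ((1 - t\<^sup>2) * (1 - y\<^sup>2) / (c - t * y)\<^sup>2) ^ k"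
    unfolding kterm_def e(1) D_def[symmetric] pw power_divide by simp
  show "kerr m c k t y = (c - t * y) powr (- (real m + 1 / 2) - 2) * ((1 - t\<^sup>2) * (1 - y\<^sup>2) / (c - t * y)\<^sup>2) ^ k"
    unfolding kerr_def e(2) D_def[symmetric] pw power_divide by simp
qed

text \<open>One \<open>N\<close> serves both estimates. Non-negative coefficients make the tail
  largest at the bound \<open>X\<close> of the argument, and the telescoped remainder is dominated
  by a term of a convergent series. The operator thus only ever acts on finite sums, never on the
  kernel itself.\<close>

lemma heine_kernel_approx:
  assumes c: "c > 1" and e: "e > 0"
  obtains N where
    "\<And>t y. t \<in> {-1..1} \<Longrightarrow> y \<in> {-1..1} \<Longrightarrow>
        \<bar>heine_kernel m c t y - (\<Sum>k\<le>N. heine_coeff m k * kterm m c k t y)\<bar> \<le> e"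
    "\<And>t y. t \<in> {-1..1} \<Longrightarrow> y \<in> {-1..1} \<Longrightarrow>
        \<bar>\<Sum>k\<le>N. heine_coeff m k * (kterm_op m c k t y - kterm_op m c k y t)\<bar> \<le> e"
proof -
  \<comment> \<open>\<open>X\<close> bounds the argument of the series; \<open>M\<close> and
    \<open>M2\<close> bound the prefactors, since \<open>c - t * y \<ge> c - 1\<close>.\<close>
  define X where "X = 1 / c\<^sup>2"
  have X: "0 \<le> X" "X < 1" using c by (auto simp: X_def)
  define M where "M = (c - 1) powr (- (real m + 1 / 2))"
  define M2 where "M2 = (c - 1) powr (- (real m + 1 / 2) - 2)"
  have "(\<lambda>N. M * (heine_series m X - (\<Sum>k\<le>N. heine_coeff m k * X ^ k))) \<longlonglongrightarrow> M * (heine_series m X - heine_series m X)"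
    unfolding heine_series_def by (intro tendsto_intros summable_LIMSEQ' summable_heine_coeff X)
  then have 1: "eventually (\<lambda>N. M * (heine_series m X - (\<Sum>k\<le>N. heine_coeff m k * X ^ k)) < e) sequentially"
    using e by (intro order_tendstoD) auto
  have "(\<lambda>N. heine_coeff2 m N * X ^ N * M2) \<longlonglongrightarrow> 0 * M2"
    by (intro tendsto_intros summable_LIMSEQ_zero summable_heine_coeff2 X)
  then have 2: "eventually (\<lambda>N. heine_coeff2 m N * X ^ N * M2 < e) sequentially"
    using e by (intro order_tendstoD) auto
  from eventually_conj[OF 1 2] obtain N where
    N: "M * (heine_series m X - (\<Sum>k\<le>N. heine_coeff m k * X ^ k)) < e" "heine_coeff2 m N * X ^ N * M2 < e"
    by (auto simp: eventually_sequentially)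
  show ?thesis
  proof (rule that[of N])
    fix t y :: real assume ty: "t \<in> {-1..1}" "y \<in> {-1..1}"
    define x where "x = (1 - t\<^sup>2) * (1 - y\<^sup>2) / (c - t * y)\<^sup>2"
    have x: "0 \<le> x" "x \<le> X" "x < 1"
      using kernel_ratio_bounds[OF c ty] X by (auto simp: x_def X_def)
    have D: "c - t * y \<ge> c - 1" "c - t * y > 0" using kernel_argument_bounds(1)[of c t y] c ty by auto
    have DM: "(c - t * y) powr (- (real m + 1 / 2)) \<le> M" "(c - t * y) powr (- (real m + 1 / 2) - 2) \<le> M2"
      unfolding M_def M2_def using D c by (auto intro!: powr_mono2')
    have tail: "heine_series m x - (\<Sum>k\<le>N. heine_coeff m k * x ^ k) = (\<Sum>k. heine_coeff m (k + Suc N) * x ^ (k + Suc N))"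
      if "0 \<le> x" "x < 1" for x
      using suminf_minus_initial_segment[OF summable_heine_coeff[OF that, of m], of "Suc N"]
      by (simp add: heine_series_def lessThan_Suc_atMost)
    have sm: "summable (\<lambda>k. heine_coeff m (k + Suc N) * x ^ (k + Suc N))" if "0 \<le> x" "x < 1" for x
      by (rule summable_ignore_initial_segment[OF summable_heine_coeff[OF that]])
    have "heine_kernel m c t y - (\<Sum>k\<le>N. heine_coeff m k * kterm m c k t y)
        = (c - t * y) powr (- (real m + 1 / 2)) * (heine_series m x - (\<Sum>k\<le>N. heine_coeff m k * x ^ k))"
      unfolding heine_kernel_def kterm_eq[OF D(2)] x_def[symmetric]
      unfolding right_diff_distrib sum_distrib_left by (simp only: mult.left_commute)
    moreover have "0 \<le> heine_series m x - (\<Sum>k\<le>N. heine_coeff m k * x ^ k)"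
      unfolding tail[OF x(1,3)] using x heine_coeff_pos[of m]
      by (intro suminf_nonneg sm mult_nonneg_nonneg) (auto intro: less_imp_le)
    moreover have "heine_series m x - (\<Sum>k\<le>N. heine_coeff m k * x ^ k)
       \<le> heine_series m X - (\<Sum>k\<le>N. heine_coeff m k * X ^ k)"
      unfolding tail[OF x(1,3)] tail[OF X] using x X heine_coeff_pos[of m]
      by (intro suminf_le sm mult_left_mono power_mono) (auto intro: less_imp_le)
    ultimately have "\<bar>heine_kernel m c t y - (\<Sum>k\<le>N. heine_coeff m k * kterm m c k t y)\<bar>
       \<le> M * (heine_series m X - (\<Sum>k\<le>N. heine_coeff m k * X ^ k))"
      using DM order_trans[OF powr_ge_zero DM(1)] by (auto simp: abs_mult intro!: mult_mono)
    then show "\<bar>heine_kernel m c t y - (\<Sum>k\<le>N. heine_coeff m k * kterm m c k t y)\<bar> \<le> e"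
      using N by linarith
    have c2: "heine_coeff2 m N \<ge> 0"
      unfolding heine_coeff2_def using heine_coeff_pos[of m N] by simp
    have ts: "t\<^sup>2 \<le> 1" "y\<^sup>2 \<le> 1" using ty by (auto simp: abs_square_le_1 abs_le_iff)
    have "\<bar>y\<^sup>2 - t\<^sup>2\<bar> \<le> 1"
      using ts zero_le_power2[of t] zero_le_power2[of y] unfolding abs_le_iff by linarith
    moreover have "\<bar>heine_coeff2 m N * kerr m c N t y\<bar> \<le> heine_coeff2 m N * (M2 * X ^ N)"
      unfolding kterm_eq[OF D(2)] x_def[symmetric] abs_mult using c2 DM order_trans[OF powr_ge_zero DM(2)] x
      by (intro mult_mono) (auto intro!: power_mono)
    ultimately have "\<bar>(y\<^sup>2 - t\<^sup>2) * (heine_coeff2 m N * kerr m c N t y)\<bar> \<le> 1 * (heine_coeff2 m N * (M2 * X ^ N))"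
      unfolding abs_mult[of "y\<^sup>2 - t\<^sup>2"] by (intro mult_mono) auto
    then show "\<bar>\<Sum>k\<le>N. heine_coeff m k * (kterm_op m c k t y - kterm_op m c k y t)\<bar> \<le> e"
      unfolding kterm_op_sum_antisym using N by (simp add: mult_ac)
  qed
qed

lemma continuous_on_heine_kernel:
  assumes c: "c > 1"
  shows "continuous_on ({-1..1} \<times> {-1..1}) (\<lambda>z. heine_kernel m c (fst z) (snd z))"
proof -
  have D: "c - fst z * snd z > 0" if "z \<in> {-1..1} \<times> {-1..1}" for z :: "real \<times> real"
    using kernel_argument_bounds(1)[of c "fst z" "snd z"] that c by auto
  have "1 / c\<^sup>2 < 1" using c by auto
  then have "continuous_on {0..1 / c\<^sup>2} (heine_series m)"
    by (intro continuous_at_imp_continuous_on ballI isCont_heine_series) auto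
  then have "continuous_on ({-1..1} \<times> {-1..1})
     (\<lambda>z. heine_series m ((1 - (fst z)\<^sup>2) * (1 - (snd z)\<^sup>2) / (c - fst z * snd z)\<^sup>2))"
  proof (rule continuous_on_compose2)
    show "continuous_on ({-1..1} \<times> {-1..1}) (\<lambda>z. (1 - (fst z)\<^sup>2) * (1 - (snd z)\<^sup>2) / (c - fst z * snd z)\<^sup>2)"
      using D by (intro continuous_intros) force
  qed (use kernel_ratio_bounds[OF c] in auto)
  then show ?thesis
    unfolding heine_kernel_def using D by (intro continuous_intros) force+
qed

lemma continuous_on_kterm:
  assumes c: "c > 1"
  shows "continuous_on ({-1..1} \<times> {-1..1}) (\<lambda>z. kterm m c k (fst z) (snd z))"
    and "continuous_on ({-1..1} \<times> {-1..1}) (\<lambda>z. kterm_op m c k (fst z) (snd z))"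
proof -
  have D: "c - fst z * snd z \<noteq> 0" if "z \<in> {-1..1} \<times> {-1..1}" for z :: "real \<times> real"
    using kernel_argument_bounds(1)[of c "fst z" "snd z"] that c by auto
  show "continuous_on ({-1..1} \<times> {-1..1}) (\<lambda>z. kterm m c k (fst z) (snd z))"
    unfolding kterm_def using D by (intro continuous_intros) blast
  show "continuous_on ({-1..1} \<times> {-1..1}) (\<lambda>z. kterm_op m c k (fst z) (snd z))"
    unfolding kterm_op_def kterm1_def kterm2_def Let_def using D by (intro continuous_intros) blast+
qed

lemma kterm_commute: "kterm m c k t y = kterm m c k y t"
  by (simp add: kterm_def mult.commute)

text \<open>The limit of the approximate statement for partial sums. It says that the image of the
  eigenfunction \<open>p\<close> is orthogonal to the operator plus \<open>\<mu>\<close> applied to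
  any test function \<open>q\<close>.\<close>

lemma heine_kernel_weakly_commutes:
  fixes p p1 p2 q q1 q2 :: "real \<Rightarrow> real"
  assumes c: "c > 1"
    and p: "\<And>t. (p has_real_derivative p1 t) (at t)" "\<And>t. (p1 has_real_derivative p2 t) (at t)"
    and eig: "\<And>t. gegenbauer_op m p1 p2 t = - \<mu> * p t"
    and q: "\<And>t. (q has_real_derivative q1 t) (at t)" "\<And>t. (q1 has_real_derivative q2 t) (at t)"
    and cq: "continuous_on {-1..1} q2"
  shows "integral {-1..1} (\<lambda>y. (1 - y\<^sup>2) ^ m * (gegenbauer_op m q1 q2 y + \<mu> * q y) *
              integral {-1..1} (\<lambda>t. (1 - t\<^sup>2) ^ m * p t * heine_kernel m c t y)) = 0"
    (is "?I = 0")
proof -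
  have cp: "continuous_on {-1..1} p" and cq0: "continuous_on {-1..1} q" and cq1: "continuous_on {-1..1} q1"
    by (rule DERIV_continuous_on[OF has_field_derivative_at_within], rule p q)+
  define Rq where "Rq y = gegenbauer_op m q1 q2 y + \<mu> * q y" for y
  have cR: "continuous_on {-1..1} Rq"
    unfolding Rq_def gegenbauer_op_def by (intro continuous_intros cq cq0 cq1)
  have bdd: "\<exists>B\<ge>0. \<forall>t\<in>{-1..1}. \<bar>f t\<bar> \<le> B" if "continuous_on {-1..1} f" for f :: "real \<Rightarrow> real"
  proof -
    have "compact (f ` {-1..1})" using that by (intro compact_continuous_image) auto
    then have "bounded (f ` {-1..1})" by (rule compact_imp_bounded)
    then obtain B where "\<forall>x\<in>f ` {-1..1}. norm x \<le> B" by (auto simp: bounded_iff)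
    then have "\<forall>t\<in>{-1..1}. \<bar>f t\<bar> \<le> max B 0" by (auto simp: le_max_iff_disj)
    then show ?thesis by (intro exI[of _ "max B 0"]) simp
  qed
  obtain P where P: "P \<ge> 0" "\<And>t. t \<in> {-1..1} \<Longrightarrow> \<bar>p t\<bar> \<le> P" using bdd[OF cp] by blast
  obtain Q where Q: "Q \<ge> 0" "\<And>t. t \<in> {-1..1} \<Longrightarrow> \<bar>q t\<bar> \<le> Q" using bdd[OF cq0] by blast
  obtain R where R: "R \<ge> 0" "\<And>t. t \<in> {-1..1} \<Longrightarrow> \<bar>Rq t\<bar> \<le> R" using bdd[OF cR] by blast
  have cw: "continuous_on {-1..1} (\<lambda>t::real. (1 - t\<^sup>2) ^ m)" by (intro continuous_intros)
  \<comment> \<open>The first summand is the commutation error of the partial sum; the second is the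
    cost of replacing the kernel by it, with a factor 2 for each of the two integrations.\<close>
  have bound: "\<bar>?I\<bar> \<le> (4 * P * Q + 4 * R * P) * e" if e: "e > 0" for e
  proof -
    obtain N where N: "\<And>t y. t \<in> {-1..1} \<Longrightarrow> y \<in> {-1..1} \<Longrightarrow>
        \<bar>heine_kernel m c t y - (\<Sum>k\<le>N. heine_coeff m k * kterm m c k t y)\<bar> \<le> e"
      "\<And>t y. t \<in> {-1..1} \<Longrightarrow> y \<in> {-1..1} \<Longrightarrow>
        \<bar>\<Sum>k\<le>N. heine_coeff m k * (kterm_op m c k t y - kterm_op m c k y t)\<bar> \<le> e"
      using heine_kernel_approx[OF c e, of m] by blast
    define S where "S t y = (\<Sum>k\<le>N. heine_coeff m k * kterm m c k t y)" for t y
    define S1 where "S1 t y = (\<Sum>k\<le>N. heine_coeff m k * kterm1 m c k t y)" for t y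
    define S2 where "S2 t y = (\<Sum>k\<le>N. heine_coeff m k * kterm2 m c k t y)" for t y
    have D: "c - t * y > 0" if "t \<in> {-1..1}" "y \<in> {-1..1}" for t y
      using kernel_argument_bounds(1)[of c t y] that c by auto
    have LS: "gegenbauer_op m (\<lambda>t. S1 t y) (\<lambda>t. S2 t y) t = (\<Sum>k\<le>N. heine_coeff m k * kterm_op m c k t y)" for t y
      unfolding gegenbauer_op_def S1_def S2_def kterm_op_def sum_distrib_left sum_subtractf[symmetric]
      by (intro sum.cong refl) algebra
    have contS: "continuous_on ({-1..1} \<times> {-1..1}) (\<lambda>z. S (fst z) (snd z))"
      unfolding S_def by (intro continuous_intros continuous_on_kterm c)
    have b1: "\<bar>integral {-1..1} (\<lambda>y. (1 - y\<^sup>2) ^ m * (gegenbauer_op m q1 q2 y + \<mu> * q y) *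
              integral {-1..1} (\<lambda>t. (1 - t\<^sup>2) ^ m * p t * S t y))\<bar> \<le> 4 * P * Q * e"
    proof (rule gegenbauer_almost_commuting_kernel[of S S1 S2 m])
      show "S t y = S y t" for t y unfolding S_def by (simp add: kterm_commute)
      show "((\<lambda>t. S t y) has_real_derivative S1 t y) (at t)" if "t \<in> {-1..1}" "y \<in> {-1..1}" for t y
        unfolding S_def S1_def by (intro DERIV_sum DERIV_cmult kterm_deriv D that)
      show "((\<lambda>t. S1 t y) has_real_derivative S2 t y) (at t)" if "t \<in> {-1..1}" "y \<in> {-1..1}" for t y
        unfolding S1_def S2_def by (intro DERIV_sum DERIV_cmult kterm1_deriv D that)
      show "continuous_on ({-1..1} \<times> {-1..1}) (\<lambda>z. gegenbauer_op m (\<lambda>t. S1 t (snd z)) (\<lambda>t. S2 t (snd z)) (fst z))"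
        unfolding LS by (intro continuous_intros continuous_on_kterm c)
      show "\<bar>gegenbauer_op m (\<lambda>t. S1 t y) (\<lambda>t. S2 t y) t - gegenbauer_op m (\<lambda>y. S1 y t) (\<lambda>y. S2 y t) y\<bar> \<le> e"
        if "t \<in> {-1..1}" "y \<in> {-1..1}" for t y
        using N(2)[OF that] unfolding LS by (simp add: sum_subtractf right_diff_distrib)
    qed (fact contS p eig q cq P Q)+
    define F where "F y = integral {-1..1} (\<lambda>t. (1 - t\<^sup>2) ^ m * p t * heine_kernel m c t y)" for y
    define G where "G y = integral {-1..1} (\<lambda>t. (1 - t\<^sup>2) ^ m * p t * S t y)" for y
    have cF: "continuous_on {-1..1} F"
      unfolding F_def by (rule continuous_on_box_integral,
        intro continuous_intros continuous_on_box_snd[OF cw] continuous_on_box_snd[OF cp]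
          continuous_on_box_swap[OF continuous_on_heine_kernel[OF c]])
    have cG: "continuous_on {-1..1} G"
      unfolding G_def by (rule continuous_on_box_integral,
        intro continuous_intros continuous_on_box_snd[OF cw] continuous_on_box_snd[OF cp]
          continuous_on_box_swap[OF contS])
    have FG: "\<bar>F y - G y\<bar> \<le> 2 * (P * e)" if y: "y \<in> {-1..1}" for y
    proof -
      note c1 = continuous_on_box_slice[OF continuous_on_heine_kernel[OF c] y]
      note c2 = continuous_on_box_slice[OF contS y]
      have "F y - G y = integral {-1..1} (\<lambda>t. (1 - t\<^sup>2) ^ m * p t * heine_kernel m c t y - (1 - t\<^sup>2) ^ m * p t * S t y)"
        unfolding F_def G_def
        by (intro integral_diff[symmetric] integrable_continuous_real continuous_intros cp c1 c2)
      also have "\<bar>\<dots>\<bar> \<le> 2 * (P * e)"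
      proof (rule integral_bound_interval)
        show "continuous_on {-1..1} (\<lambda>t. (1 - t\<^sup>2) ^ m * p t * heine_kernel m c t y - (1 - t\<^sup>2) ^ m * p t * S t y)"
          by (intro continuous_intros cp c1 c2)
        fix t :: real assume t: "t \<in> {-1..1}"
        have "\<bar>(1 - t\<^sup>2) ^ m * p t * heine_kernel m c t y - (1 - t\<^sup>2) ^ m * p t * S t y\<bar>
            = \<bar>(1 - t\<^sup>2) ^ m\<bar> * (\<bar>p t\<bar> * \<bar>heine_kernel m c t y - S t y\<bar>)"
          unfolding abs_mult[symmetric] by (simp only: right_diff_distrib mult.assoc)
        also have "\<dots> \<le> 1 * (P * e)"
          using weight_bounds[OF t, of m] P N(1)[OF t y] t unfolding S_def by (intro mult_mono) auto
        finally show "\<bar>(1 - t\<^sup>2) ^ m * p t * heine_kernel m c t y - (1 - t\<^sup>2) ^ m * p t * S t y\<bar> \<le> P * e" by simp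
      qed
      finally show ?thesis .
    qed
    have "?I - integral {-1..1} (\<lambda>y. (1 - y\<^sup>2) ^ m * Rq y * G y)
       = integral {-1..1} (\<lambda>y. (1 - y\<^sup>2) ^ m * Rq y * F y - (1 - y\<^sup>2) ^ m * Rq y * G y)"
      unfolding F_def[symmetric] Rq_def[symmetric]
      by (intro integral_diff[symmetric] integrable_continuous_real continuous_intros cR cF cG)
    also have "\<bar>\<dots>\<bar> \<le> 2 * (R * (2 * (P * e)))"
    proof (rule integral_bound_interval)
      show "continuous_on {-1..1} (\<lambda>y. (1 - y\<^sup>2) ^ m * Rq y * F y - (1 - y\<^sup>2) ^ m * Rq y * G y)"
        by (intro continuous_intros cR cF cG)
      fix y :: real assume y: "y \<in> {-1..1}"
      have "\<bar>(1 - y\<^sup>2) ^ m * Rq y * F y - (1 - y\<^sup>2) ^ m * Rq y * G y\<bar>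
          = \<bar>(1 - y\<^sup>2) ^ m\<bar> * (\<bar>Rq y\<bar> * \<bar>F y - G y\<bar>)"
        unfolding abs_mult[symmetric] by (simp only: right_diff_distrib mult.assoc)
      also have "\<dots> \<le> 1 * (R * (2 * (P * e)))"
        using weight_bounds[OF y, of m] R FG[OF y] y by (intro mult_mono) auto
      finally show "\<bar>(1 - y\<^sup>2) ^ m * Rq y * F y - (1 - y\<^sup>2) ^ m * Rq y * G y\<bar> \<le> R * (2 * (P * e))" by simp
    qed
    finally have "\<bar>?I\<bar> \<le> 2 * (R * (2 * (P * e))) + 4 * P * Q * e"
      using b1 unfolding G_def[symmetric] Rq_def[symmetric] by linarith
    then show ?thesis by (simp add: algebra_simps)
  qed
  define K where "K = 4 * P * Q + 4 * R * P"
  have "K \<ge> 0" unfolding K_def using P Q R by simp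
  have "\<bar>?I\<bar> \<le> 0"
  proof (rule field_le_epsilon)
    fix e :: real assume "e > 0"
    \<comment> \<open>Dividing by \<open>K + 1\<close> instead of \<open>K\<close> covers
      \<open>K = 0\<close>.\<close>
    have "\<bar>?I\<bar> \<le> K * (e / (K + 1))" using \<open>e > 0\<close> \<open>K \<ge> 0\<close> by (intro bound[folded K_def]) auto
    also have "\<dots> \<le> e" using \<open>e > 0\<close> \<open>K \<ge> 0\<close> by (simp add: field_simps)
    finally show "\<bar>?I\<bar> \<le> 0 + e" by simp
  qed
  then show ?thesis by simp
qed

section \<open>Eigenfunctions of the kernel\<close>

text \<open>The weight is positive only inside the interval when \<open>m > 0\<close>; the endpoints
  follow by continuity of \<open>g\<close>.\<close>

lemma weighted_square_integral_eq_0: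
  fixes g :: "real \<Rightarrow> real"
  assumes cg: "continuous_on {-1..1} g" and 0: "integral {-1..1} (\<lambda>t. (1 - t\<^sup>2) ^ m * (g t)\<^sup>2) = 0"
    and t: "t \<in> {-1..1}"
  shows "g t = 0"
proof -
  have "\<forall>t\<in>{-1..1}. (1 - t\<^sup>2) ^ m * (g t)\<^sup>2 = 0"
    using 0 by (subst (asm) integral_eq_0_iff) (auto intro!: continuous_intros cg mult_nonneg_nonneg weight_bounds[THEN conjunct1])
  then have *: "(1 - t\<^sup>2) ^ m * (g t)\<^sup>2 = 0" if "t \<in> {-1<..<1}" for t using that by auto
  have "g t = 0" if "t \<in> {-1<..<1}" for t
  proof -
    have "t\<^sup>2 \<noteq> 1" using that by (auto simp: power2_eq_1_iff)
    then show ?thesis using *[OF that] by simp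
  qed
  moreover have "closure {-1<..<1::real} = {-1..1}" by simp
  ultimately show ?thesis
    using continuous_constant_on_closure[of "{-1<..<1::real}" g 0 t] cg t by auto
qed

text \<open>For a polynomial \<open>g\<close> close to \<open>f\<close>, orthogonality gives that
  the integral of \<open>w f^2\<close> equals that of \<open>w f (f - g)\<close>, which is
  small.\<close>

lemma orthogonal_to_monomials_imp_0:
  fixes f :: "real \<Rightarrow> real"
  assumes cf: "continuous_on {-1..1} f"
    and orth: "\<And>k. integral {-1..1} (\<lambda>t. (1 - t\<^sup>2) ^ m * f t * t ^ k) = 0"
    and t: "t \<in> {-1..1}"
  shows "f t = 0"
proof (rule weighted_square_integral_eq_0[OF cf _ t])
  let ?I = "integral {-1..1} (\<lambda>t. (1 - t\<^sup>2) ^ m * (f t)\<^sup>2)"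
  have "bounded (f ` {-1..1})"
    by (intro compact_imp_bounded compact_continuous_image cf) auto
  then obtain B where B: "B > 0" "\<And>t. t \<in> {-1..1} \<Longrightarrow> \<bar>f t\<bar> \<le> B"
    by (auto simp: bounded_pos)
  have "\<bar>?I\<bar> \<le> 0"
  proof (rule field_le_epsilon)
    fix e :: real assume e: "e > 0"
    have "e / (2 * B) > 0" using e B by simp
    then obtain g where g: "real_polynomial_function g" "\<And>t. t \<in> {-1..1} \<Longrightarrow> \<bar>f t - g t\<bar> < e / (2 * B)"
      using Stone_Weierstrass_real_polynomial_function[of "{-1..1}" f "e / (2 * B)"] cf by auto
    then obtain a N where gs: "g = (\<lambda>x. \<Sum>i\<le>N. a i * x ^ i)"
      using real_polynomial_function_iff_sum by blast
    have cg: "continuous_on {-1..1} g" unfolding gs by (intro continuous_intros)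
    have "integral {-1..1} (\<lambda>t. (1 - t\<^sup>2) ^ m * f t * g t)
        = integral {-1..1} (\<lambda>t. \<Sum>i\<le>N. a i * ((1 - t\<^sup>2) ^ m * f t * t ^ i))"
      unfolding gs by (simp add: sum_distrib_left mult_ac)
    also have "\<dots> = (\<Sum>i\<le>N. integral {-1..1} (\<lambda>t. a i * ((1 - t\<^sup>2) ^ m * f t * t ^ i)))"
      by (intro integral_sum integrable_continuous_real continuous_intros cf) auto
    also have "\<dots> = 0" using orth by simp
    finally have "?I = ?I - integral {-1..1} (\<lambda>t. (1 - t\<^sup>2) ^ m * f t * g t)" by simp
    also have "\<dots> = integral {-1..1} (\<lambda>t. (1 - t\<^sup>2) ^ m * (f t)\<^sup>2 - (1 - t\<^sup>2) ^ m * f t * g t)"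
      by (intro integral_diff[symmetric] integrable_continuous_real continuous_intros cf cg)
    also have "\<bar>\<dots>\<bar> \<le> 2 * (B * (e / (2 * B)))"
    proof (rule integral_bound_interval)
      show "continuous_on {-1..1} (\<lambda>t. (1 - t\<^sup>2) ^ m * (f t)\<^sup>2 - (1 - t\<^sup>2) ^ m * f t * g t)"
        by (intro continuous_intros cf cg)
      fix t :: real assume t: "t \<in> {-1..1}"
      have "\<bar>(1 - t\<^sup>2) ^ m * (f t)\<^sup>2 - (1 - t\<^sup>2) ^ m * f t * g t\<bar> = \<bar>(1 - t\<^sup>2) ^ m\<bar> * (\<bar>f t\<bar> * \<bar>f t - g t\<bar>)"
        unfolding abs_mult[symmetric] by (simp add: right_diff_distrib power2_eq_square mult_ac)
      also have "\<dots> \<le> 1 * (B * (e / (2 * B)))"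
        using weight_bounds[OF t, of m] B g(2)[OF t] t by (intro mult_mono) auto
      finally show "\<bar>(1 - t\<^sup>2) ^ m * (f t)\<^sup>2 - (1 - t\<^sup>2) ^ m * f t * g t\<bar> \<le> B * (e / (2 * B))" by simp
    qed
    also have "\<dots> = e" using B by simp
    finally show "\<bar>?I\<bar> \<le> 0 + e" by simp
  qed
  then show "?I = 0" by simp
qed

text \<open>The operator is triangular on monomials; its diagonal entries determine which moments
  the orthogonality relations force to vanish.\<close>

lemma gegenbauer_op_monomial:
  "gegenbauer_op m (\<lambda>t. real k * t ^ (k - 1)) (\<lambda>t. real k * (real (k - 1) * t ^ (k - 2))) t
     = real k * real (k - 1) * t ^ (k - 2) - real k * (real k + 2 * real m + 1) * t ^ k"
proof -
  consider "k = 0" | "k = 1" | j where "k = Suc (Suc j)"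
    by (metis One_nat_def not0_implies_Suc)
  then show ?thesis
    by cases (simp_all add: gegenbauer_op_def algebra_simps power2_eq_square)
qed

text \<open>Subtracting from \<open>F\<close> its projection on \<open>p\<close> leaves a function
  \<open>f\<close> orthogonal to \<open>p\<close> and to the operator plus \<open>\<mu>\<close>
  applied to every monomial. The second property is a two-step recurrence for the moments of
  \<open>f\<close>, solvable except at \<open>k = d\<close>, where orthogonality to \<open>p\<close>
  steps in. Hence all moments vanish and \<open>f = 0\<close>.\<close>

lemma heine_kernel_eigenfunction:
  fixes p p1 p2 :: "real poly"
  assumes c: "c > 1" and pd: "p1 = pderiv p" "p2 = pderiv p1" and deg: "degree p = d"
    and eig: "\<And>t. gegenbauer_op m (poly p1) (poly p2) t = - (real d * (real d + 2 * real m + 1)) * poly p t"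
    and p1: "poly p 1 \<noteq> 0" and y: "y \<in> {-1..1}"
  defines "F \<equiv> \<lambda>y. integral {-1..1} (\<lambda>t. (1 - t\<^sup>2) ^ m * poly p t * heine_kernel m c t y)"
  shows "F y = F 1 / poly p 1 * poly p y"
proof -
  define \<mu> where "\<mu> = real d * (real d + 2 * real m + 1)"
  define w where "w t = (1 - t\<^sup>2) ^ m" for t :: real
  have cw: "continuous_on {-1..1} w" unfolding w_def by (intro continuous_intros)
  have cp: "continuous_on {-1..1} (poly p)" by (intro continuous_intros)
  have cF: "continuous_on {-1..1} F"
    unfolding F_def w_def[symmetric] by (rule continuous_on_box_integral,
      intro continuous_intros continuous_on_box_snd[OF cw] continuous_on_box_snd[OF cp]
        continuous_on_box_swap[OF continuous_on_heine_kernel[OF c]])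
  define A where "A = integral {-1..1} (\<lambda>t. w t * (poly p t)\<^sup>2)"
  have A: "A \<noteq> 0"
    using weighted_square_integral_eq_0[OF cp, of m 1] p1 unfolding A_def w_def by auto
  \<comment> \<open>The projection coefficient, chosen so that \<open>F - C * p\<close> is
    orthogonal to \<open>p\<close> for the weight.\<close>
  define C where "C = integral {-1..1} (\<lambda>t. w t * F t * poly p t) / A"
  define f where "f t = F t - C * poly p t" for t
  have cf: "continuous_on {-1..1} f" unfolding f_def by (intro continuous_intros cF)
  define \<Phi> where "\<Phi> q = integral {-1..1} (\<lambda>t. w t * f t * q t)" for q
  have intble: "(\<lambda>t. w t * f t * q t) integrable_on {-1..1}" if "continuous_on {-1..1} q" for q
    by (intro integrable_continuous_real continuous_intros cw cf that)
  have lin: "\<Phi> (\<lambda>t. a * q t + b * s t) = a * \<Phi> q + b * \<Phi> s"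
    if "continuous_on {-1..1} q" "continuous_on {-1..1} s" for a b q s
  proof -
    have "\<Phi> (\<lambda>t. a * q t + b * s t) = integral {-1..1} (\<lambda>t. a * (w t * f t * q t) + b * (w t * f t * s t))"
      unfolding \<Phi>_def by (simp add: algebra_simps)
    also have "\<dots> = a * \<Phi> q + b * \<Phi> s"
      unfolding \<Phi>_def by (subst integral_add) (auto intro!: integrable_on_mult_right intble that)
    finally show ?thesis .
  qed
  have \<Phi>p: "\<Phi> (poly p) = 0"
  proof -
    have "\<Phi> (poly p) = integral {-1..1} (\<lambda>t. w t * F t * poly p t - C * (w t * (poly p t)\<^sup>2))"
      unfolding \<Phi>_def f_def by (simp add: algebra_simps power2_eq_square)
    also have "\<dots> = integral {-1..1} (\<lambda>t. w t * F t * poly p t) - integral {-1..1} (\<lambda>t. C * (w t * (poly p t)\<^sup>2))"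
      by (intro integral_diff integrable_continuous_real continuous_intros cw cF)
    also have "\<dots> = 0" using A by (simp add: C_def A_def[symmetric])
    finally show ?thesis .
  qed
  have dp: "(poly p has_real_derivative poly p1 t) (at t)" "(poly p1 has_real_derivative poly p2 t) (at t)" for t
    unfolding pd by (rule poly_DERIV)+
  have eig': "gegenbauer_op m (poly p1) (poly p2) t = - \<mu> * poly p t" for t
    using eig[of t] by (simp add: \<mu>_def)
  have rec: "(\<mu> - real k * (real k + 2 * real m + 1)) * \<Phi> (\<lambda>t. t ^ k) + real k * real (k - 1) * \<Phi> (\<lambda>t. t ^ (k - 2)) = 0" for k
  proof -
    define q1 where "q1 = (\<lambda>t::real. real k * t ^ (k - 1))"
    define q2 where "q2 = (\<lambda>t::real. real k * (real (k - 1) * t ^ (k - 2)))"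
    define L where "L t = gegenbauer_op m q1 q2 t + \<mu> * t ^ k" for t
    have dq: "((\<lambda>t. t ^ k) has_real_derivative q1 t) (at t)" for t
      unfolding q1_def by (auto intro!: derivative_eq_intros)
    have dq1: "(q1 has_real_derivative q2 t) (at t)" for t
      unfolding q1_def q2_def using DERIV_pow[of "k - 1" t UNIV]
      by (intro DERIV_cmult) (simp add: numeral_2_eq_2)
    have cq2: "continuous_on {-1..1} q2" "continuous_on {-1..1} q1"
      unfolding q2_def q1_def by (intro continuous_intros)+
    have cL: "continuous_on {-1..1} L"
      unfolding L_def gegenbauer_op_def by (intro continuous_intros cq2)
    have 1: "integral {-1..1} (\<lambda>t. w t * L t * F t) = 0"
      unfolding w_def L_def F_def
      by (rule heine_kernel_weakly_commutes[OF c dp eig' dq dq1 cq2(1)])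
    have "((\<lambda>t. w t * gegenbauer_op m q1 q2 t * poly p t - w t * t ^ k * gegenbauer_op m (poly p1) (poly p2) t)
        has_integral 0) {-1..1}"
      unfolding w_def by (intro gegenbauer_op_selfadjoint dp dq dq1)
    then have 2: "integral {-1..1} (\<lambda>t. w t * L t * poly p t) = 0"
      unfolding eig' L_def by (intro integral_unique) (simp add: algebra_simps)
    have "\<Phi> L = integral {-1..1} (\<lambda>t. w t * L t * F t - C * (w t * L t * poly p t))"
      unfolding \<Phi>_def f_def by (simp add: algebra_simps)
    also have "\<dots> = integral {-1..1} (\<lambda>t. w t * L t * F t) - integral {-1..1} (\<lambda>t. C * (w t * L t * poly p t))"
      by (intro integral_diff integrable_continuous_real continuous_intros cw cF cL)
    also have "\<dots> = 0" using 1 2 by simp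
    finally have "\<Phi> L = 0" .
    moreover have "L = (\<lambda>t. (\<mu> - real k * (real k + 2 * real m + 1)) * t ^ k + real k * real (k - 1) * t ^ (k - 2))"
      unfolding L_def q1_def q2_def gegenbauer_op_monomial by (auto simp: algebra_simps)
    ultimately show ?thesis by (simp only: lin[OF continuous_on_power[OF continuous_on_id] continuous_on_power[OF continuous_on_id]])
  qed
  have "\<Phi> (\<lambda>t. t ^ k) = 0" for k
  proof (induction k rule: less_induct)
    case (less k)
    show ?case
    proof (cases "k = d")
      case False
      \<comment> \<open>For \<open>k < 2\<close> the truncated index \<open>k - 2\<close> is not
        covered by the induction hypothesis, but the prefactor is zero.\<close>
      have "real k * real (k - 1) * \<Phi> (\<lambda>t. t ^ (k - 2)) = 0"
        using less[of "k - 2"] by (cases "k < 2") (auto simp: less_2_cases_iff)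
      with rec[of k] have "(\<mu> - real k * (real k + 2 * real m + 1)) * \<Phi> (\<lambda>t. t ^ k) = 0"
        by (simp only: add_0_right)
      moreover have "\<mu> - real k * (real k + 2 * real m + 1) = (real d - real k) * (real d + real k + 2 * real m + 1)"
        by (simp add: \<mu>_def algebra_simps)
      moreover have "real d - real k \<noteq> 0" "real d + real k + 2 * real m + 1 > 0" using False by auto
      ultimately show ?thesis by simp
    next
      case True
      \<comment> \<open>At \<open>k = d\<close> the recurrence has coefficient zero. Expanding
        \<open>p\<close> in monomials, all lower moments vanish, so only the leading one
        remains.\<close>
      have "\<Phi> (poly p) = integral {-1..1} (\<lambda>t. \<Sum>i\<le>d. coeff p i * (w t * f t * t ^ i))"
        unfolding \<Phi>_def poly_altdef deg by (simp add: sum_distrib_left mult_ac)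
      also have "\<dots> = (\<Sum>i\<le>d. coeff p i * \<Phi> (\<lambda>t. t ^ i))"
        unfolding \<Phi>_def by (subst integral_sum) (auto intro!: integrable_on_mult_right intble continuous_intros)
      also have "\<dots> = (\<Sum>i\<in>{d}. coeff p i * \<Phi> (\<lambda>t. t ^ i))"
        using less True by (intro sum.mono_neutral_right) auto
      finally have "coeff p d * \<Phi> (\<lambda>t. t ^ d) = 0" using \<Phi>p by simp
      moreover have "coeff p d \<noteq> 0" using p1 deg by (metis leading_coeff_0_iff poly_0)
      ultimately show ?thesis using True by simp
    qed
  qed
  then have f0: "f t = 0" if "t \<in> {-1..1}" for t
    using orthogonal_to_monomials_imp_0[OF cf, of m t] that unfolding \<Phi>_def w_def by blast
  have "F 1 = C * poly p 1" using f0[of 1] by (simp add: f_def)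
  moreover have "F y = C * poly p y" using f0[OF y] by (simp add: f_def)
  ultimately show ?thesis using p1 by simp
qed

text \<open>The eigenvalue comes from \<open>y = 1\<close>, where the argument of the series is zero
  and the pole integral applies. The degree \<open>d = n - m\<close> gives
  \<open>d (d + 2 m + 1) = (n - m)(n + m + 1)\<close>.\<close>

lemma has_integral_heine_kernel:
  fixes r y :: real
  assumes mn: "m \<le> n" and r: "0 < r" "r < 1" and y: "y \<in> {-1..1}"
  defines "c \<equiv> (1 + r\<^sup>2) / (2 * r)"
  shows "((\<lambda>t. (1 - t\<^sup>2) ^ m * poly (legendre_deriv n m) t * heine_kernel m c t y) has_integral
           2 * pi / (2 * real n + 1) * r powr (real n + 1 / 2) / heine_const m * poly (legendre_deriv n m) y) {-1..1}"
proof -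
  define p where "p = legendre_deriv n m"
  have c: "c > 1" unfolding c_def using r by (rule half_sum_inverse_gt_1)
  define F where "F y = integral {-1..1} (\<lambda>t. (1 - t\<^sup>2) ^ m * poly p t * heine_kernel m c t y)" for y
  have p1: "poly p 1 \<noteq> 0" using legendre_deriv_at_1_nonzero[OF mn] by (simp add: p_def)
  have "F y = F 1 / poly p 1 * poly p y"
    unfolding F_def
  proof (rule heine_kernel_eigenfunction[OF c refl refl _ _ p1 y])
    show "degree p = n - m" by (simp add: p_def degree_legendre_deriv)
    show "gegenbauer_op m (poly (pderiv p)) (poly (pderiv (pderiv p))) t
        = - (real (n - m) * (real (n - m) + 2 * real m + 1)) * poly p t" for t
      using legendre_deriv_ode[where x = t and n = n and m = m] mn
      by (simp add: gegenbauer_op_def p_def of_nat_diff)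
  qed
  moreover have "F 1 = 2 * pi / (2 * real n + 1) * r powr (real n + 1 / 2) * poly p 1 / heine_const m"
    using has_integral_heine_pole[OF mn r] unfolding F_def heine_kernel_def p_def c_def[symmetric]
    by (intro integral_unique) simp
  ultimately have "F y = 2 * pi / (2 * real n + 1) * r powr (real n + 1 / 2) / heine_const m * poly p y"
    using p1 by simp
  moreover have "((\<lambda>t. (1 - t\<^sup>2) ^ m * poly p t * heine_kernel m c t y) has_integral F y) {-1..1}"
    unfolding F_def
    by (intro integrable_integral integrable_continuous_real continuous_intros
          continuous_on_box_slice[OF continuous_on_heine_kernel[OF c] y])
  ultimately show ?thesis by (simp add: p_def)
qed

section \<open>The singular case\<close>

lemma has_integral_heine_kernel_cos:
  fixes r y :: real
  assumes mn: "m \<le> n" and r: "0 < r" "r < 1" and y: "y \<in> {-1..1}"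
  defines "c \<equiv> (1 + r\<^sup>2) / (2 * r)"
  shows "((\<lambda>\<theta>. sin \<theta> ^ (2 * m) * poly (legendre_deriv n m) (cos \<theta>) * heine_kernel m c (cos \<theta>) y * sin \<theta>) has_integral
           2 * pi / (2 * real n + 1) * r powr (real n + 1 / 2) / heine_const m * poly (legendre_deriv n m) y) {0..pi}"
proof -
  have c: "c > 1" unfolding c_def using r by (intro half_sum_inverse_gt_1)
  define f where "f t = (1 - t\<^sup>2) ^ m * poly (legendre_deriv n m) t * heine_kernel m c t y" for t
  have cf: "continuous_on {-1..1} f"
    unfolding f_def by (intro continuous_intros continuous_on_box_slice[OF continuous_on_heine_kernel[OF c] y])
  \<comment> \<open>Since \<open>cos\<close> decreases, \<open>{cos 0..cos pi}\<close> is empty and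
    its integral is zero; the second integral carries the orientation sign.\<close>
  have "((\<lambda>\<theta>. - sin \<theta> *\<^sub>R f (cos \<theta>)) has_integral (integral {cos 0..cos pi} f - integral {cos pi..cos 0} f)) {0..pi}"
    by (rule has_integral_substitution_general[of "{}" 0 pi cos "-1" 1])
       (auto intro!: continuous_intros derivative_eq_intros cf)
  then have "((\<lambda>\<theta>. - sin \<theta> * f (cos \<theta>)) has_integral - integral {-1..1} f) {0..pi}" by simp
  from has_integral_neg[OF this] have "((\<lambda>\<theta>. f (cos \<theta>) * sin \<theta>) has_integral integral {-1..1} f) {0..pi}"
    by (simp add: mult.commute)
  also have "(\<lambda>\<theta>. f (cos \<theta>) * sin \<theta>) =
     (\<lambda>\<theta>. sin \<theta> ^ (2 * m) * poly (legendre_deriv n m) (cos \<theta>) * heine_kernel m c (cos \<theta>) y * sin \<theta>)"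
    unfolding f_def by (simp add: power_mult flip: sin_squared_eq)
  also have "integral {-1..1} f = 2 * pi / (2 * real n + 1) * r powr (real n + 1 / 2) / heine_const m * poly (legendre_deriv n m) y"
    unfolding f_def c_def by (intro integral_unique has_integral_heine_kernel mn r y)
  finally show ?thesis .
qed

context
  fixes t y :: real
  assumes t: "t \<in> {-1..1}" and y: "y \<in> {-1<..<1}" and ty: "t \<noteq> y"
begin

text \<open>Since \<open>(1 - t y)^2 - (1 - t^2)(1 - y^2) = (t - y)^2\<close>, the argument of the
  series stays below 1 off the diagonal even for \<open>c = 1\<close>.\<close>

lemma off_diagonal_bounds:
  assumes "c \<ge> 1"
  shows "c - t * y > 0" "0 \<le> (1 - t\<^sup>2) * (1 - y\<^sup>2) / (c - t * y)\<^sup>2" "(1 - t\<^sup>2) * (1 - y\<^sup>2) / (c - t * y)\<^sup>2 < 1"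
proof -
  have "\<bar>t\<bar> * \<bar>y\<bar> \<le> 1 * \<bar>y\<bar>" using t by (intro mult_right_mono) auto
  also have "\<dots> < 1" using y by auto
  finally have "t * y < 1" using abs_ge_self[of "t * y"] by (simp add: abs_mult)
  then have D1: "1 - t * y > 0" by simp
  then show D: "c - t * y > 0" using assms by simp
  show "0 \<le> (1 - t\<^sup>2) * (1 - y\<^sup>2) / (c - t * y)\<^sup>2"
    using kernel_argument_bounds(2)[OF assms t, of y] y by simp
  have "(1 - t * y)\<^sup>2 - (1 - t\<^sup>2) * (1 - y\<^sup>2) = (t - y)\<^sup>2" by (simp add: power2_eq_square algebra_simps)
  moreover have "(t - y)\<^sup>2 > 0" using ty by simp
  moreover have "(1 - t * y)\<^sup>2 \<le> (c - t * y)\<^sup>2" using D1 assms by (intro power_mono) auto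
  ultimately have "(1 - t\<^sup>2) * (1 - y\<^sup>2) < (c - t * y)\<^sup>2" by linarith
  then show "(1 - t\<^sup>2) * (1 - y\<^sup>2) / (c - t * y)\<^sup>2 < 1" using D by (simp add: divide_less_eq_1)
qed

lemma heine_kernel_antimono:
  assumes "1 \<le> c" "c \<le> c'"
  shows "heine_kernel m c' t y \<le> heine_kernel m c t y"
proof -
  note b = off_diagonal_bounds[OF assms(1)] and b' = off_diagonal_bounds[OF order_trans[OF assms]]
  have "(1 - t\<^sup>2) * (1 - y\<^sup>2) / (c' - t * y)\<^sup>2 \<le> (1 - t\<^sup>2) * (1 - y\<^sup>2) / (c - t * y)\<^sup>2"
    using assms b(1) kernel_argument_bounds(2)[OF assms(1) t, of y] y
    by (intro divide_left_mono power_mono) auto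
  then show ?thesis
    unfolding heine_kernel_def using b b' assms
    by (intro mult_mono heine_series_mono heine_series_nonneg powr_mono2') auto
qed

lemma heine_kernel_nonneg: "1 \<le> c \<Longrightarrow> 0 \<le> heine_kernel m c t y"
  unfolding heine_kernel_def using off_diagonal_bounds
  by (intro mult_nonneg_nonneg heine_series_nonneg) auto

lemma heine_kernel_tendsto:
  assumes "f \<longlonglongrightarrow> 1"
  shows "(\<lambda>k. heine_kernel m (f k) t y) \<longlonglongrightarrow> heine_kernel m 1 t y"
proof -
  note b = off_diagonal_bounds[OF order_refl]
  show ?thesis
    unfolding heine_kernel_def using b(1)
    by (intro tendsto_mult isCont_tendsto_compose[OF isCont_heine_series[OF b(2,3)]] tendsto_intros assms) auto
qed

end

lemma has_integral_heine_kernel_cos_1: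
  fixes \<theta>' :: real
  assumes mn: "m \<le> n" and \<theta>': "0 < \<theta>'" "\<theta>' < pi"
  shows "((\<lambda>\<theta>. sin \<theta> ^ (2 * m) * poly (legendre_deriv n m) (cos \<theta>) * heine_kernel m 1 (cos \<theta>) (cos \<theta>') * sin \<theta>) has_integral
           2 * pi / (2 * real n + 1) / heine_const m * poly (legendre_deriv n m) (cos \<theta>')) {0..pi}"
proof -
  define y where "y = cos \<theta>'"
  have y: "y \<in> {-1<..<1}" "y \<in> {-1..1}"
    using \<theta>' cos_monotone_0_pi[of 0 \<theta>'] cos_monotone_0_pi[of \<theta>' pi] by (auto simp: y_def)
  \<comment> \<open>The singular point is removed; a single point does not affect the
    integrals.\<close>
  define S where "S = {0..pi} - {\<theta>'}"
  \<comment> \<open>Any sequence increasing to 1 inside \<open>(0, 1)\<close> would do; the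
    corresponding \<open>c k\<close> decreases to 1.\<close>
  define r where "r k = (real k + 1) / (real k + 2)" for k
  have r: "0 < r k" "r k < 1" for k by (auto simp: r_def)
  define c where "c k = (1 + (r k)\<^sup>2) / (2 * r k)" for k
  have c1: "c k > 1" for k unfolding c_def using r by (intro half_sum_inverse_gt_1)
  have rlim: "r \<longlonglongrightarrow> 1" unfolding r_def by real_asymp
  have clim: "c \<longlonglongrightarrow> 1" unfolding c_def r_def by real_asymp
  have cdec: "c (Suc k) \<le> c k" for k
  proof -
    define u where "u = r k"
    define v where "v = r (Suc k)"
    have uv: "0 < u" "u \<le> v" "v < 1" using r by (auto simp: u_def v_def) (simp add: r_def field_simps)
    \<comment> \<open>Monotonicity of \<open>c\<close> rests on
      \<open>(1 + u^2) v - (1 + v^2) u = (1 - u v)(v - u)\<close>.\<close>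
    have "u * v \<le> 1" using uv by (intro mult_le_one) auto
    then have "0 \<le> (1 - u * v) * (v - u)" using uv by (intro mult_nonneg_nonneg) auto
    then have "(1 + v\<^sup>2) * u \<le> (1 + u\<^sup>2) * v" by (simp add: power2_eq_square algebra_simps)
    then show ?thesis unfolding c_def u_def[symmetric] v_def[symmetric] using uv by (simp add: field_simps)
  qed
  have S: "cos \<theta> \<in> {-1..1}" "cos \<theta> \<noteq> y" "sin \<theta> \<ge> 0" if "\<theta> \<in> S" for \<theta>
    using that \<theta>' cos_inj_pi[of \<theta> \<theta>'] by (auto simp: S_def y_def sin_ge_zero)
  have spike: "(f has_integral I) S \<longleftrightarrow> (f has_integral I) {0..pi}" for f :: "real \<Rightarrow> real" and I
    unfolding S_def by (rule has_integral_spike_set_eq; rule negligible_subset[of "{\<theta>'}"]) auto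
  define g where "g k \<theta> = sin \<theta> ^ (2 * m) * heine_kernel m (c k) (cos \<theta>) y * sin \<theta>" for k \<theta>
  define h where "h \<theta> = sin \<theta> ^ (2 * m) * heine_kernel m 1 (cos \<theta>) y * sin \<theta>" for \<theta>
  define M where "M = 2 * pi / (2 * real m + 1) / heine_const m"
  have g_int: "(g k has_integral M * r k powr (real m + 1 / 2)) S" for k
  proof -
    \<comment> \<open>The constant value of \<open>D^m P_m\<close>; dividing the case
      \<open>n = m\<close> by it gives the integral of the bare kernel.\<close>
    define a where "a = poly (legendre_deriv m m) 1"
    have a: "a \<noteq> 0" "poly (legendre_deriv m m) x = a" for x
      using legendre_deriv_at_1_nonzero[of m m] legendre_deriv_top[of m x] by (auto simp: a_def)
    have "((\<lambda>\<theta>. g k \<theta> * a) has_integral M * r k powr (real m + 1 / 2) * a) {0..pi}"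
      using has_integral_heine_kernel_cos[OF order_refl r y(2), of m k]
      unfolding g_def c_def M_def a(2) by (simp add: mult_ac)
    from has_integral_divide[OF this, of a] a(1) show ?thesis by (simp add: spike)
  qed
  have h_int: "h integrable_on S"
  proof -
    \<comment> \<open>The \<open>g k\<close> increase because the \<open>c k\<close> decrease, and
      their integrals stay below \<open>M\<close> because \<open>r k < 1\<close>.\<close>
    have "h integrable_on S \<and> (\<lambda>k. integral S (g k)) \<longlonglongrightarrow> integral S h"
    proof (rule monotone_convergence_increasing)
      show "g k integrable_on S" for k using g_int by blast
      show "g k \<theta> \<le> g (Suc k) \<theta>" if "\<theta> \<in> S" for k \<theta>
        unfolding g_def using S[OF that] y c1 cdec[of k]
        by (intro mult_right_mono mult_left_mono heine_kernel_antimono) (auto intro: less_imp_le)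
      show "(\<lambda>k. g k \<theta>) \<longlonglongrightarrow> h \<theta>" if "\<theta> \<in> S" for \<theta>
        unfolding g_def h_def using S[OF that] y by (intro tendsto_intros heine_kernel_tendsto clim)
      have "M \<ge> 0" unfolding M_def using heine_const_pos[of m] by simp
      moreover have "r k powr (real m + 1 / 2) \<le> 1" for k using r[of k] by (intro powr_le1) auto
      ultimately have "\<bar>integral S (g k)\<bar> \<le> M" for k
        using g_int[of k] by (simp add: integral_unique abs_mult mult_left_le)
      then show "bounded (range (\<lambda>k. integral S (g k)))" by (auto simp: bounded_iff)
    qed
    then show ?thesis ..
  qed
  define p where "p = poly (legendre_deriv n m)"
  have "bounded (p ` {-1..1})"
    unfolding p_def by (intro compact_imp_bounded compact_continuous_image continuous_intros) auto
  then obtain P where P: "\<And>t. t \<in> {-1..1} \<Longrightarrow> \<bar>p t\<bar> \<le> P" unfolding bounded_iff by fastforce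
  define K where "K = 2 * pi / (2 * real n + 1) / heine_const m * p y"
  define f where "f k \<theta> = p (cos \<theta>) * g k \<theta>" for k \<theta>
  have f_int: "(f k has_integral K * r k powr (real n + 1 / 2)) S" for k
    using has_integral_heine_kernel_cos[OF mn r y(2), of k]
    unfolding f_def g_def c_def K_def p_def spike by (simp add: mult_ac)
  have dom: "norm (f k \<theta>) \<le> P * h \<theta>" if "\<theta> \<in> S" for k \<theta>
  proof -
    have "0 \<le> g k \<theta>" "g k \<theta> \<le> h \<theta>"
      unfolding g_def h_def using S[OF that] y c1
      by (auto intro!: mult_nonneg_nonneg mult_right_mono mult_left_mono heine_kernel_antimono heine_kernel_nonneg
          intro: less_imp_le)
    then show ?thesis unfolding f_def using P[OF S(1)[OF that]]
      by (auto simp: abs_mult intro!: mult_mono)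
  qed
  have lim: "(\<lambda>k. f k \<theta>) \<longlonglongrightarrow> p (cos \<theta>) * h \<theta>" if "\<theta> \<in> S" for \<theta>
    unfolding f_def g_def h_def using S[OF that] y by (intro tendsto_intros heine_kernel_tendsto clim)
  note dc = dominated_convergence[OF has_integral_integrable[OF f_int] integrable_on_mult_right[OF h_int] dom lim]
  have "(\<lambda>\<theta>. p (cos \<theta>) * h \<theta>) integrable_on S" by (rule dc(1))
  moreover have "(\<lambda>k. integral S (f k)) \<longlonglongrightarrow> integral S (\<lambda>\<theta>. p (cos \<theta>) * h \<theta>)" by (rule dc(2))
  moreover have "(\<lambda>k. integral S (f k)) \<longlonglongrightarrow> K * 1 powr (real n + 1 / 2)"
    unfolding f_int[THEN integral_unique] by (intro tendsto_intros rlim) simp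
  ultimately have "((\<lambda>\<theta>. p (cos \<theta>) * h \<theta>) has_integral K) S"
    by (simp add: has_integral_iff LIMSEQ_unique)
  then show ?thesis unfolding spike h_def K_def p_def y_def by (simp add: mult_ac)
qed

section \<open>Reduction to the kernel\<close>

text \<open>For \<open>nu = m - 1/2\<close> and real \<open>z > 1\<close> all parameters and bases
  are real or positive real, so the complex Gamma values, powers and series are images of real ones.
  Convergence holds because \<open>1 / z^2 < 1\<close>.\<close>

lemma legendreQ0_of_real:
  assumes z: "z > 1"
  shows "legendreQ0 (of_nat m - 1 / 2) (of_real z)
     = of_real (heine_const m * z powr (- (real m + 1 / 2)) * heine_series m (1 / z\<^sup>2))"
proof -
  define \<nu> :: complex where "\<nu> = of_nat m - 1 / 2"
  have \<nu>: "\<nu> + 0 + 1 = of_real (real m + 1 / 2)" "\<nu> + 1 = of_real (real m + 1 / 2)" by (simp_all add: \<nu>_def)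
  have h: "(\<nu> + 0) / 2 + 1 = of_real (real m / 2 + 3 / 4)" "of_real (real m + 1 / 2) / 2 = (of_real (real m / 2 + 1 / 4) :: complex)"
      "\<nu> + 3 / 2 = of_real (real m + 1)"
    by (simp_all add: \<nu>_def field_simps)
  have z2: "1 / z\<^sup>2 \<ge> 0" "1 / z\<^sup>2 < 1" using z by auto
  have Gm: "Gamma (real m + 1) = fact m" using Gamma_fact[of m, where 'a = real] by (simp add: add.commute)
  have hyp: "hyp2F1_reg (of_real (real m / 2 + 3 / 4)) (of_real (real m / 2 + 1 / 4)) (of_real (real m + 1)) (1 / (of_real z)\<^sup>2)
      = of_real (heine_series m (1 / z\<^sup>2) / fact m)"
  proof -
    have "(\<Sum>k. pochhammer (of_real (real m / 2 + 3 / 4)) k * pochhammer (of_real (real m / 2 + 1 / 4)) k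
              / (pochhammer (of_real (real m + 1)) k * fact k) * (1 / (of_real z)\<^sup>2) ^ k :: complex)
        = (\<Sum>k. of_real (heine_coeff m k * (1 / z\<^sup>2) ^ k))"
      unfolding heine_coeff_def pochhammer_of_real by simp
    also have "\<dots> = of_real (heine_series m (1 / z\<^sup>2))"
      unfolding heine_series_def by (rule suminf_of_real[OF summable_heine_coeff[OF z2], symmetric])
    finally show ?thesis
      unfolding hyp2F1_reg_def Gamma_complex_of_real Gm by simp
  qed
  \<comment> \<open>A power with base 0 and exponent 0 is 0 here, so the factor with exponent
    \<open>mu / 2 = 0\<close> is 1 only for a non-zero base.\<close>
  have "z\<^sup>2 \<noteq> 1" using z by (simp add: power2_eq_1_iff)
  then have "(complex_of_real z)\<^sup>2 - 1 \<noteq> 0" by (metis eq_iff_diff_eq_0 of_real_1 of_real_eq_iff of_real_power)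
  then have p0: "((complex_of_real z)\<^sup>2 - 1) powr (0 / 2) = 1" by simp
  have P: "(2::complex) powr (of_real (real m + 1 / 2)) = of_real (2 powr (real m + 1 / 2))"
     "complex_of_real z powr (of_real (real m + 1 / 2)) = of_real (z powr (real m + 1 / 2))"
    using powr_of_real[of 2 "real m + 1 / 2"] powr_of_real[of z "real m + 1 / 2"] z by simp_all
  have "legendreQ0 \<nu> (of_real z) = of_real (sqrt pi * Gamma (real m + 1 / 2) / (2 powr (real m + 1 / 2) * z powr (real m + 1 / 2))
     * (heine_series m (1 / z\<^sup>2) / fact m))"
    unfolding legendreQ0_def legendreQ_def \<nu> h hyp p0 P Gamma_complex_of_real by simp
  also have "sqrt pi * Gamma (real m + 1 / 2) / (2 powr (real m + 1 / 2) * z powr (real m + 1 / 2))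
     * (heine_series m (1 / z\<^sup>2) / fact m) = heine_const m * z powr (- (real m + 1 / 2)) * heine_series m (1 / z\<^sup>2)"
    unfolding heine_const_def powr_minus_divide by simp
  finally show ?thesis unfolding \<nu>_def .
qed

text \<open>With \<open>u = s - \<tau>\<close> and \<open>v = s' - \<tau>'\<close>, the Pythagorean
  identities make the numerator of \<open>chi\<close> a multiple of \<open>2 u v\<close>. Positivity
  of \<open>u\<close> and \<open>v\<close> lets this factor cancel.\<close>

lemma chi_eq:
  assumes "sin \<theta> \<noteq> 0" "sin \<theta>' \<noteq> 0" "\<sigma> > 0" "\<sigma>' > 0"
  shows "chi \<sigma> \<theta> \<sigma>' \<theta>' = (cosh (\<sigma> - \<sigma>') - cos \<theta> * cos \<theta>') / (sin \<theta> * sin \<theta>')"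
proof -
  have ch: "cosh \<sigma> > 1" "cosh \<sigma>' > 1" using cosh_real_strict_mono[of 0] assms by auto
  define u where "u = cosh \<sigma> - cos \<theta>"
  define v where "v = cosh \<sigma>' - cos \<theta>'"
  have uv: "u > 0" "v > 0" using ch cos_le_one[of \<theta>] cos_le_one[of \<theta>'] unfolding u_def v_def by linarith+
  have e: "sinh \<sigma> ^ 2 = cosh \<sigma> ^ 2 - 1" "sinh \<sigma>' ^ 2 = cosh \<sigma>' ^ 2 - 1"
     "sin \<theta> ^ 2 = 1 - cos \<theta> ^ 2" "sin \<theta>' ^ 2 = 1 - cos \<theta>' ^ 2"
    using cosh_square_eq[of \<sigma>] cosh_square_eq[of \<sigma>'] by (simp_all add: sin_squared_eq)
  have "(sin \<theta>)\<^sup>2 * v\<^sup>2 + (sin \<theta>')\<^sup>2 * u\<^sup>2 + (v * sinh \<sigma> - u * sinh \<sigma>')\<^sup>2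
      = (cosh \<sigma> * cosh \<sigma>' - sinh \<sigma> * sinh \<sigma>' - cos \<theta> * cos \<theta>') * (2 * u * v)"
    using e unfolding u_def v_def by algebra
  then have "chi \<sigma> \<theta> \<sigma>' \<theta>' = ((cosh \<sigma> * cosh \<sigma>' - sinh \<sigma> * sinh \<sigma>' - cos \<theta> * cos \<theta>') * (2 * u * v))
        / (2 * sin \<theta> * sin \<theta>' * u * v)"
    unfolding chi_def Let_def u_def[symmetric] v_def[symmetric] by simp
  also have "\<dots> = (cosh \<sigma> * cosh \<sigma>' - sinh \<sigma> * sinh \<sigma>' - cos \<theta> * cos \<theta>') / (sin \<theta> * sin \<theta>')"
    using uv assms by (simp add: field_simps)
  finally show ?thesis by (simp add: cosh_diff)
qed

theorem theorem3p5:
  fixes m n :: nat and \<sigma> \<sigma>' \<theta>' :: real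
  assumes "m \<le> n" and "0 < \<sigma>" and "0 < \<sigma>'" and "0 < \<theta>'" and "\<theta>' < pi"
  shows "((\<lambda>\<theta>. Re (legendreQ0 (of_nat m - 1 / 2) (of_real (chi \<sigma> \<theta> \<sigma>' \<theta>')))
              * ferrersP m n (cos \<theta>) * sqrt (sin \<theta>))
          has_integral
           (2 * pi * sqrt (sin \<theta>') / (2 * real n + 1) * ferrersP m n (cos \<theta>')
             * exp (- (real n + 1 / 2) * (max \<sigma> \<sigma>' - min \<sigma> \<sigma>')))) {0..pi}"
proof -
  define c where "c = cosh (\<sigma> - \<sigma>')"
  \<comment> \<open>With this \<open>r\<close> one has \<open>c = (1 + r^2) / (2 r)\<close>, and
    \<open>r < 1\<close> exactly when \<open>\<sigma> \<noteq> \<sigma>'\<close>.\<close>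
  define r where "r = exp (- \<bar>\<sigma> - \<sigma>'\<bar>)"
  define y where "y = cos \<theta>'"
  define s' where "s' = sin \<theta>'"
  define p where "p = poly (legendre_deriv n m)"
  have s': "s' > 0" using assms by (simp add: s'_def sin_gt_zero)
  have s2': "1 - y\<^sup>2 = s'\<^sup>2" by (simp add: y_def s'_def sin_squared_eq)
  have c: "c \<ge> 1" by (simp add: c_def cosh_real_ge_1)
  have H: "((\<lambda>\<theta>. sin \<theta> ^ (2 * m) * p (cos \<theta>) * heine_kernel m c (cos \<theta>) y * sin \<theta>) has_integral
           2 * pi / (2 * real n + 1) * r powr (real n + 1 / 2) / heine_const m * p y) {0..pi}"
  proof (cases "\<sigma> = \<sigma>'")
    case True
    then show ?thesis
      using has_integral_heine_kernel_cos_1[OF assms(1,4,5)] by (simp add: c_def r_def y_def p_def)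
  next
    case False
    have "c = cosh \<bar>\<sigma> - \<sigma>'\<bar>" by (simp add: c_def)
    also have "\<dots> = (1 / r + r) / 2" by (simp add: cosh_def r_def exp_minus inverse_eq_divide)
    also have "\<dots> = (1 + r\<^sup>2) / (2 * r)" by (simp add: r_def field_simps power2_eq_square)
    finally have "c = (1 + r\<^sup>2) / (2 * r)" .
    moreover have "0 < r" "r < 1" using False by (auto simp: r_def)
    moreover have "y \<in> {-1..1}" by (simp add: y_def)
    ultimately show ?thesis using has_integral_heine_kernel_cos[OF assms(1), of r y] by (simp add: p_def)
  qed
  \<comment> \<open>Collects the factors independent of \<open>\<theta>\<close>: the constant of
    \<open>Q\<close>, the power of \<open>sin \<theta>'\<close>, and the sign of the Ferrers
    function.\<close>
  define B where "B = heine_const m * s' powr (real m + 1 / 2) * (- 1) ^ m"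
  have "((\<lambda>\<theta>. Re (legendreQ0 (of_nat m - 1 / 2) (of_real (chi \<sigma> \<theta> \<sigma>' \<theta>')))
              * ferrersP m n (cos \<theta>) * sqrt (sin \<theta>)) has_integral
      B * (2 * pi / (2 * real n + 1) * r powr (real n + 1 / 2) / heine_const m * p y)) {0..pi}"
  proof (rule has_integral_spike[OF _ _ has_integral_mult_right[OF H, of B]])
    \<comment> \<open>At the endpoints \<open>chi\<close> divides by
      \<open>sin \<theta> = 0\<close>, and at \<open>\<theta>'\<close> the kernel may be
      singular.\<close>
    show "negligible {0, pi, \<theta>'}" by simp
    fix \<theta> assume \<theta>: "\<theta> \<in> {0..pi} - {0, pi, \<theta>'}"
    define s where "s = sin \<theta>"
    define t where "t = cos \<theta>"
    define D where "D = c - t * y"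
    define x where "x = (1 - t\<^sup>2) * (1 - y\<^sup>2) / D\<^sup>2"
    have s: "s > 0" using \<theta> by (auto simp: s_def intro!: sin_gt_zero)
    have s2: "1 - t\<^sup>2 = s\<^sup>2" by (simp add: t_def s_def sin_squared_eq)
    have "t \<noteq> y" using \<theta> assms cos_inj_pi[of \<theta> \<theta>'] by (auto simp: t_def y_def)
    moreover have "y \<in> {-1<..<1}"
      using assms cos_monotone_0_pi[of 0 \<theta>'] cos_monotone_0_pi[of \<theta>' pi] by (auto simp: y_def)
    moreover have "t \<in> {-1..1}" by (simp add: t_def)
    ultimately have b: "D > 0" "x < 1"
      using off_diagonal_bounds[of t y c] c by (auto simp: D_def x_def)
    define z where "z = D / (s * s')"
    have chi: "chi \<sigma> \<theta> \<sigma>' \<theta>' = z"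
      using chi_eq[of \<theta> \<theta>' \<sigma> \<sigma>'] s s' assms by (simp add: z_def D_def c_def t_def y_def s_def s'_def)
    have z0: "z > 0" using b s s' by (simp add: z_def)
    have xz: "x = 1 / z\<^sup>2" unfolding x_def z_def s2 s2' by (simp add: power_divide power_mult_distrib)
    \<comment> \<open>Equivalent to the argument \<open>x = 1 / z^2\<close> of the series being
      below 1, which holds off the diagonal.\<close>
    have "z > 1"
    proof (rule ccontr)
      assume "\<not> z > 1"
      then have "z\<^sup>2 \<le> 1" using z0 by (simp add: power_le_one)
      then show False using b(2) z0 unfolding xz by simp
    qed
    from legendreQ0_of_real[OF this, of m]
    have Q: "Re (legendreQ0 (of_nat m - 1 / 2) (of_real z)) = heine_const m * z powr (- (real m + 1 / 2)) * heine_series m x"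
      unfolding xz by simp
    have zp: "z powr (- (real m + 1 / 2)) = D powr (- (real m + 1 / 2)) * s powr (real m + 1 / 2) * s' powr (real m + 1 / 2)"
    proof -
      have "(D / (s * s')) powr (- a) = D powr (- a) * s powr a * s' powr a" for a
        using b s s' by (simp add: powr_divide powr_mult powr_minus divide_simps)
      then show ?thesis unfolding z_def .
    qed
    have F: "ferrersP m n t = (- 1) ^ m * s ^ m * p t"
    proof -
      have "(s\<^sup>2) powr (real m / 2) = s ^ m"
        using s by (simp add: powr_powr powr_realpow flip: powr_numeral)
      then show ?thesis unfolding ferrersP_def s2 p_def by simp
    qed
    \<comment> \<open>The powers of \<open>sin \<theta>\<close> from \<open>Q\<close>, from the
      Ferrers function and from the square root combine to the weight \<open>(1 - t^2)^m\<close> and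
      the Jacobian of \<open>t = cos \<theta>\<close>.\<close>
    have sp: "s powr (real m + 1 / 2) * s ^ m * sqrt s = s ^ (2 * m) * s"
    proof -
      have "s powr (real m + 1 / 2) * s ^ m * sqrt s = s powr (real m + 1 / 2) * s powr real m * s powr (1 / 2)"
        using s by (simp add: powr_realpow powr_half_sqrt)
      also have "\<dots> = s powr (real (2 * m + 1))" unfolding powr_add[symmetric] by simp
      also have "\<dots> = s ^ (2 * m + 1)" using s by (rule powr_realpow)
      finally show ?thesis by simp
    qed
    have "Re (legendreQ0 (of_nat m - 1 / 2) (of_real (chi \<sigma> \<theta> \<sigma>' \<theta>'))) * ferrersP m n (cos \<theta>) * sqrt (sin \<theta>)
       = heine_const m * s' powr (real m + 1 / 2) * (- 1) ^ m * p t * (D powr (- (real m + 1 / 2)) * heine_series m x)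
           * (s powr (real m + 1 / 2) * s ^ m * sqrt s)"
      unfolding chi Q zp t_def[symmetric] s_def[symmetric] F by (simp only: mult_ac)
    also have "\<dots> = B * (sin \<theta> ^ (2 * m) * p (cos \<theta>) * heine_kernel m c (cos \<theta>) y * sin \<theta>)"
      unfolding sp B_def heine_kernel_def s_def[symmetric] t_def[symmetric] D_def[symmetric] x_def[symmetric]
      by (simp only: mult_ac)
    finally show "Re (legendreQ0 (of_nat m - 1 / 2) (of_real (chi \<sigma> \<theta> \<sigma>' \<theta>'))) * ferrersP m n (cos \<theta>) * sqrt (sin \<theta>)
       = B * (sin \<theta> ^ (2 * m) * p (cos \<theta>) * heine_kernel m c (cos \<theta>) y * sin \<theta>)" .
  qed
  moreover have "B * (2 * pi / (2 * real n + 1) * r powr (real n + 1 / 2) / heine_const m * p y)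
      = 2 * pi * sqrt (sin \<theta>') / (2 * real n + 1) * ferrersP m n (cos \<theta>')
             * exp (- (real n + 1 / 2) * (max \<sigma> \<sigma>' - min \<sigma> \<sigma>'))"
  proof -
    have "s' powr (real m + 1 / 2) = sqrt s' * s' ^ m"
      using s' by (simp add: powr_add powr_realpow powr_half_sqrt)
    moreover have "(s'\<^sup>2) powr (real m / 2) = s' ^ m"
      using s' by (simp add: powr_powr powr_realpow flip: powr_numeral)
    then have "ferrersP m n y = (- 1) ^ m * s' ^ m * p y" unfolding ferrersP_def s2' p_def by simp
    moreover have "max \<sigma> \<sigma>' - min \<sigma> \<sigma>' = \<bar>\<sigma> - \<sigma>'\<bar>" by (simp add: max_def min_def)
    then have "exp (- (real n + 1 / 2) * (max \<sigma> \<sigma>' - min \<sigma> \<sigma>')) = r powr (real n + 1 / 2)"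
      by (simp add: powr_def r_def algebra_simps)
    moreover have "h * (q * k) * e * (2 * pi / N * R / h * v) = 2 * pi * q / N * (e * k * v) * R"
      if "h > 0" for h q k e N R v :: real
      using that by simp
    ultimately show ?thesis
      using heine_const_pos[of m] unfolding B_def y_def[symmetric] s'_def[symmetric] by (simp only:)
  qed
  ultimately show ?thesis by simp
qed

end
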